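(* For every $z_0\in\mathbb{C}\setminus\mathbb{Z}_{<0}$ the remainder Cesàro sum $R_+[\ln](z_0)=\sum_{n=1}^{\infty}\ln(z_0+n)$ exists (as a generalised geometric Cesàro limit), so that $$\tilde\Gamma(z_0+1):=\exp\left(R_+[\ln](0)-R_+[\ln](z_0)\right)$$ is well-defined on all of $\mathbb{C}\setminus\mathbb{Z}_{<0}$; and $\tilde\Gamma$ is the classical Gamma function, i.e. $\tilde\Gamma(z_0+1)=\Gamma(z_0+1)$ for all $z_0\in\mathbb{C}\setminus\mathbb{Z}_{<0}$.
   Context: Here $\ln$ is the principal branch ($-\pi<\arg\le\pi$). Remainder Cesàro sum: for a function $f$ and $z_0\in\mathbb{C}$, consider the horizontal contour $\gamma(t)=z_0+t$, $t\ge0$. Write $t=k+\alpha$ with $k\in\mathbb{Z}_{\ge0}$, $0\le\alpha<1$, so a point of the contour is $z=z_0+k+\alpha$. The partial-sum function is $s_f(z_0;z)=s_f(z_0;z_0+k+\alpha):=\sum_{n=1}^{k}f(z_0+n)$. Then $R_+[f](z_0)$ is defined as the generalised geometric Cesàro limit of $s_f(z_0;z)$ along $\gamma$, when it exists. Generalised geometric Cesàro limit along $\gamma$: a function $F$ on $\gamma$ has generalised Cesàro limit $L$ if it can be written as $$F(t)=\sum_{j=1}^{n}a_j\,(\gamma(t))^{\rho_j}\,(\ln \gamma(t))^{m_j}+R(t)$$ for some finite collection of constants $a_j\in\mathbb{C}$, $\rho_j\in\mathbb{C}\setminus\{0\}$, $m_j\in\mathbb{Z}_{\ge 0}$ and some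 remainder function $R$ for which there is $N\in\mathbb{Z}_{\ge0}$ with $P^N[R](t)\to L$ classically as $t\to\infty$, where $P[h](t)=\frac1t\int_0^t h(u)\,du$. For such horizontal rays the limit, when it exists, is unique. *)

theory Defs
  imports "HOL-Analysis.Analysis"
begin

definition cesaro_mean :: "(real \<Rightarrow> complex) \<Rightarrow> real \<Rightarrow> complex" where
  "cesaro_mean h t = integral {0..t} h / of_real t"

text \<open>
  The integrability clause says that all the averages forming the \<open>N\<close>-th iterate exist; without
  it, \<^const>\<open>integral\<close> would silently take the value 0. Complex powers and logarithms are principal.
  At a parameter with \<open>\<gamma> t = 0\<close> the library's total functions give \<open>0 powr \<rho> = 0\<close>; this can happen
  for at most one \<open>t\<close> on a horizontal ray, and a single value affects neither the integrals nor
  the limit.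
\<close>

definition has_gen_cesaro_limit ::
    "(real \<Rightarrow> complex) \<Rightarrow> (real \<Rightarrow> complex) \<Rightarrow> complex \<Rightarrow> bool" where
  "has_gen_cesaro_limit \<gamma> F L \<longleftrightarrow>
     (\<exists>(n::nat) (a :: nat \<Rightarrow> complex) (\<rho> :: nat \<Rightarrow> complex) (m :: nat \<Rightarrow> nat)
        (R :: real \<Rightarrow> complex) (N::nat).
        (\<forall>j\<in>{1..n}. \<rho> j \<noteq> 0) \<and>
        (\<forall>t\<ge>0. F t = (\<Sum>j=1..n. a j * \<gamma> t powr \<rho> j * ln (\<gamma> t) ^ m j) + R t) \<and>
        (\<forall>k<N. \<forall>t\<ge>0. (cesaro_mean ^^ k) R integrable_on {0..t}) \<and>
        (((cesaro_mean ^^ N) R) \<longlongrightarrow> L) at_top)"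

definition horizontal_ray :: "complex \<Rightarrow> real \<Rightarrow> complex" where
  "horizontal_ray z0 t = z0 + of_real t"

text \<open>
  The partial-sum function \<open>s_f(z0; z)\<close> at the contour point \<open>z = z0 + t\<close>, in terms of the
  parameter \<open>t = k + \<alpha>\<close> with \<open>k = \<lfloor>t\<rfloor>\<close>.
\<close>

definition partial_sum_fun :: "(complex \<Rightarrow> complex) \<Rightarrow> complex \<Rightarrow> real \<Rightarrow> complex" where
  "partial_sum_fun f z0 t = (\<Sum>n=1..nat \<lfloor>t\<rfloor>. f (z0 + of_nat n))"

definition has_remainder_cesaro_sum ::
    "(complex \<Rightarrow> complex) \<Rightarrow> complex \<Rightarrow> complex \<Rightarrow> bool" where
  "has_remainder_cesaro_sum f z0 L \<longleftrightarrow>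
     has_gen_cesaro_limit (horizontal_ray z0) (partial_sum_fun f z0) L"

definition remainder_cesaro_sum :: "(complex \<Rightarrow> complex) \<Rightarrow> complex \<Rightarrow> complex" where
  "remainder_cesaro_sum f z0 = (THE L. has_remainder_cesaro_sum f z0 L)"

definition Gamma_tilde :: "complex \<Rightarrow> complex" where
  "Gamma_tilde w = exp (remainder_cesaro_sum ln 0 - remainder_cesaro_sum ln (w - 1))"

end

theory Submission
  imports Defs "HOL-Real_Asymp.Real_Asymp"
begin

text \<open>
Write \<open>\<gamma> = z + t\<close>, let \<open>F\<close> be the partial-sum function of \<open>ln\<close> and let \<open>c\<close> be the constant in
Stirling's formula for \<open>ln (n!)\<close>.

Existence and value. Stirling's formula and the limit formula defining \<open>ln_Gamma\<close> together give
\<open>F = \<gamma> ln \<gamma> - \<gamma> + (1/2 - frac t) ln t + C + o(1)\<close> with \<open>C = c - Ln z - ln_Gamma z\<close>, and \<open>C = c\<close> for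
\<open>z = 0\<close> (lemma \<open>partial_sum_ln_expansion\<close>). The first two terms are gauge terms with exponent 1, and
the third has an antiderivative of size \<open>O(ln t)\<close>, so a single averaging removes it. Hence the
Cesaro sum is \<open>C\<close>, and the difference of the values at \<open>0\<close> and \<open>z\<close> is \<open>ln_Gamma z + Ln z\<close>, whose
exponential is \<open>z Gamma z = Gamma (z + 1)\<close>.

Uniqueness. If \<open>F = g + R\<close> is any admissible decomposition with \<open>P^N R\<close> tending to \<open>L\<close>, then
\<open>R - L\<close> is the sum of \<open>\<gamma> ln \<gamma> - \<gamma> - g\<close>, of the constant \<open>C - L\<close>, of an oscillating term that
averages out, and of \<open>o(1)\<close>. Collect the first two into terms \<open>p\<^sub>\<beta>(ln \<gamma>) \<gamma> powr \<beta>\<close> with polynomials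
\<open>p\<^sub>\<beta>\<close>. As no gauge exponent is zero, the exponent \<open>\<beta> = 0\<close> carries exactly \<open>C - L\<close>; if this is nonzero, then
the largest real part \<open>\<sigma>\<close> of an occurring exponent is nonnegative. Up to \<open>o(t powr \<sigma>)\<close>, only the terms with
\<open>Re \<beta> = \<sigma>\<close> matter, and in them \<open>\<gamma>\<close> may be replaced by \<open>t\<close> (lemma \<open>exp_poly_leading_part\<close>). Averaging
keeps this shape: each \<open>p\<^sub>\<beta>\<close> becomes another nonzero polynomial (lemma \<open>cesaro_mean_expansion\<close>). So a
nontrivial exponential polynomial in \<open>s = ln t\<close>, all of whose exponents have real part \<open>\<sigma>\<close>, would be
\<open>o(exp (\<sigma> s))\<close>, which is impossible (lemma \<open>exp_poly_not_negligible\<close>). Comparing leading terms in this way,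
instead of discarding the gauge terms one by one, is what copes with the shift \<open>z\<close>: for example
\<open>\<gamma> = t + z\<close> contains the constant \<open>z\<close> when it is expanded in powers of \<open>t\<close>.
\<close>

section \<open>Exponential polynomials on the real line\<close>

text \<open>
With \<open>s = ln w\<close> this is a sum of terms \<open>p\<^sub>\<beta>(ln w) w powr \<beta>\<close>, the shape of all gauge terms; working in \<open>s\<close>
turns dilations of \<open>w\<close> into translations.
\<close>

definition exp_poly :: "complex set \<Rightarrow> (complex \<Rightarrow> complex poly) \<Rightarrow> complex \<Rightarrow> complex" where
  "exp_poly B p s = (\<Sum>\<beta>\<in>B. poly (p \<beta>) s * exp (\<beta> * s))"

lemma degree_shift_diff_less:
  fixes p :: "complex poly"
  assumes "degree p > 0" "c \<noteq> 0"
  shows "pcompose p [:c, 1:] - p \<noteq> 0" "degree (pcompose p [:c, 1:] - p) < degree p"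
proof -
  have deg: "degree (pcompose p [:c, 1:]) = degree p"
    by (simp add: degree_pcompose)
  have lead: "lead_coeff (pcompose p [:c, 1:]) = lead_coeff p"
    by (subst lead_coeff_comp) auto
  show "degree (pcompose p [:c, 1:] - p) < degree p"
  proof (rule degree_lessI)
    show "\<forall>k\<ge>degree p. coeff (pcompose p [:c, 1:] - p) k = 0"
    proof (intro allI impI)
      fix k assume "k \<ge> degree p"
      then show "coeff (pcompose p [:c, 1:] - p) k = 0"
        using lead deg by (cases "k = degree p") (auto simp: coeff_eq_0)
    qed
  qed (use assms in auto)
  show "pcompose p [:c, 1:] - p \<noteq> 0"
  proof
    assume "pcompose p [:c, 1:] - p = 0"
    then have "poly (pcompose p [:c, 1:]) x = poly p x" for x by simp
    then have *: "poly p (c + x) = poly p x" for x by (simp add: poly_pcompose)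
    have "poly p (of_nat n * c) = poly p 0" for n
    proof (induction n)
      case (Suc n)
      then show ?case using *[of "of_nat n * c"] by (simp add: distrib_right)
    qed simp
    then have "range (\<lambda>n. of_nat n * c) \<subseteq> {x. poly (p - [:poly p 0:]) x = 0}"
      by auto
    moreover have "infinite (range (\<lambda>n. of_nat n * c))"
      by (rule range_inj_infinite) (use assms in \<open>auto intro!: injI\<close>)
    ultimately have "p - [:poly p 0:] = 0"
      using poly_roots_finite infinite_super by blast
    then show False using assms
      by (metis degree_pCons_0 eq_iff_diff_eq_0 less_irrefl)
  qed
qed

text \<open>
Two different exponents are told apart by every sufficiently short translation, because the solutions of
\<open>exp x = 1\<close> other than \<open>0\<close> have modulus at least \<open>2 pi\<close>.
\<close>

lemma exists_separating_step:
  fixes B :: "complex set"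
  assumes "finite B"
  shows "\<exists>c::real. c > 0 \<and> (\<forall>\<beta>\<in>B. \<beta> \<noteq> \<beta>0 \<longrightarrow> exp ((\<beta> - \<beta>0) * of_real c) \<noteq> 1)"
proof -
  define M where "M = (\<Sum>\<beta>\<in>B. norm (\<beta> - \<beta>0))"
  have M: "M \<ge> 0" by (simp add: M_def sum_nonneg)
  show ?thesis
  proof (intro exI[of _ "1 / (1 + M)"] conjI ballI impI notI)
    fix \<beta> assume \<beta>: "\<beta> \<in> B" "\<beta> \<noteq> \<beta>0" and e: "exp ((\<beta> - \<beta>0) * of_real (1 / (1 + M))) = 1"
    let ?z = "(\<beta> - \<beta>0) * of_real (1 / (1 + M))"
    have "norm (\<beta> - \<beta>0) \<le> M"
      unfolding M_def using \<beta> assms by (intro member_le_sum) auto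
    then have "norm ?z \<le> 1" using M
      unfolding norm_mult norm_of_real by (simp add: divide_le_eq)
    moreover obtain n :: int where n: "Re ?z = 0" "Im ?z = of_int (2 * n) * pi"
      using e unfolding exp_eq_1 by blast
    ultimately have "\<bar>of_int (2 * n) * pi\<bar> \<le> 1"
      using abs_Im_le_cmod[of ?z] by (simp only:)
    moreover have "\<bar>of_int (2 * n) * pi\<bar> \<ge> 2 * pi" if "n \<noteq> 0"
    proof -
      have "\<bar>of_int n\<bar> \<ge> (1::real)" using that by linarith
      then show ?thesis by (simp add: abs_mult)
    qed
    ultimately have "n = 0" using pi_gt3 by (smt (verit))
    then have "?z = 0" using n by (intro complex_eqI) auto
    moreover have "complex_of_real (1 / (1 + M)) \<noteq> 0"
      unfolding of_real_eq_0_iff using M by simp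
    ultimately show False using \<beta> by (simp only: mult_eq_0_iff) auto
  qed (use M in auto)
qed

text \<open>
Induction on the total size of the polynomials. The twisted difference \<open>exp (- \<beta>0 c) f (s + c) - f s\<close>
preserves negligibility. It lowers the degree of the polynomial at \<open>\<beta>0\<close> (a constant disappears), while
all other degrees stay the same when \<open>c\<close> separates the exponents. One is left with a single term
\<open>a exp (\<beta> s)\<close>, and its modulus is exactly \<open>\<bar>a\<bar> exp (\<sigma> s)\<close>.
\<close>

lemma exp_poly_not_negligible:
  assumes "finite B" "B \<noteq> {}" "\<And>\<beta>. \<beta> \<in> B \<Longrightarrow> p \<beta> \<noteq> 0" "\<And>\<beta>. \<beta> \<in> B \<Longrightarrow> Re \<beta> = \<sigma>"
  shows "\<not> ((\<lambda>s. exp_poly B p (of_real s) * of_real (exp (- \<sigma> * s))) \<longlongrightarrow> 0) at_top"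
  using assms
proof (induction "\<Sum>\<beta>\<in>B. degree (p \<beta>) + 1" arbitrary: B p rule: less_induct)
  case less
  show ?case
  proof
    assume lim: "((\<lambda>s. exp_poly B p (of_real s) * of_real (exp (- \<sigma> * s))) \<longlongrightarrow> 0) at_top"
    obtain \<beta>0 where \<beta>0: "\<beta>0 \<in> B" using less.prems by auto
    obtain c :: real where c: "c > 0"
        "\<And>\<beta>. \<beta> \<in> B \<Longrightarrow> \<beta> \<noteq> \<beta>0 \<Longrightarrow> exp ((\<beta> - \<beta>0) * of_real c) \<noteq> 1"
      using exists_separating_step[OF less.prems(1)] by blast
    define q where "q \<beta> = smult (exp ((\<beta> - \<beta>0) * of_real c)) (pcompose (p \<beta>) [:of_real c, 1:]) - p \<beta>" for \<beta>
    have ep: "exp_poly A q s = exp (- \<beta>0 * of_real c) * exp_poly A p (s + of_real c) - exp_poly A p s" for A s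
      unfolding exp_poly_def sum_distrib_left sum_subtractf[symmetric] q_def
      by (intro sum.cong refl) (simp add: poly_pcompose algebra_simps exp_add exp_diff exp_minus divide_simps)
    have "((\<lambda>s. exp_poly B p (of_real (s + c)) * of_real (exp (- \<sigma> * (s + c)))) \<longlongrightarrow> 0) at_top"
      by (rule filterlim_compose[OF lim]) real_asymp
    from tendsto_diff[OF tendsto_mult[OF tendsto_const[of "exp (- \<beta>0 * of_real c) * of_real (exp (\<sigma> * c))"] this] lim]
    have lim2: "((\<lambda>s. exp (- \<beta>0 * of_real c) * of_real (exp (\<sigma> * c)) *
          (exp_poly B p (of_real (s + c)) * of_real (exp (- \<sigma> * (s + c))))
          - exp_poly B p (of_real s) * of_real (exp (- \<sigma> * s))) \<longlongrightarrow> 0) at_top"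
      by (simp only: mult_zero_right diff_self)
    have limq: "((\<lambda>s. exp_poly B q (of_real s) * of_real (exp (- \<sigma> * s))) \<longlongrightarrow> 0) at_top"
    proof (rule Lim_transform_eventually[OF lim2], intro always_eventually allI)
      fix s :: real
      have "exp (\<sigma> * c) * exp (- \<sigma> * (s + c)) = exp (- \<sigma> * s)"
        by (simp add: algebra_simps flip: exp_add)
      then have E: "complex_of_real (exp (\<sigma> * c)) * of_real (exp (- \<sigma> * (s + c))) = of_real (exp (- \<sigma> * s))"
        unfolding of_real_mult[symmetric] by (rule arg_cong)
      have "exp (- \<beta>0 * of_real c) * of_real (exp (\<sigma> * c)) *
          (exp_poly B p (of_real (s + c)) * of_real (exp (- \<sigma> * (s + c))))
          = exp (- \<beta>0 * of_real c) * exp_poly B p (of_real (s + c)) *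
            (of_real (exp (\<sigma> * c)) * of_real (exp (- \<sigma> * (s + c))))"
        by (simp only: mult_ac)
      also have "\<dots> = exp (- \<beta>0 * of_real c) * exp_poly B p (of_real s + of_real c) * of_real (exp (- \<sigma> * s))"
        unfolding E of_real_add ..
      finally show "exp (- \<beta>0 * of_real c) * of_real (exp (\<sigma> * c)) *
          (exp_poly B p (of_real (s + c)) * of_real (exp (- \<sigma> * (s + c))))
          - exp_poly B p (of_real s) * of_real (exp (- \<sigma> * s))
          = exp_poly B q (of_real s) * of_real (exp (- \<sigma> * s))"
        by (simp only: ep left_diff_distrib)
    qed
    have q_other: "q \<beta> \<noteq> 0 \<and> degree (q \<beta>) \<le> degree (p \<beta>)" if "\<beta> \<in> B" "\<beta> \<noteq> \<beta>0" for \<beta>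
    proof
      have "lead_coeff (pcompose (p \<beta>) [:of_real c, 1:]) = lead_coeff (p \<beta>)"
        by (subst lead_coeff_comp) auto
      then have "coeff (q \<beta>) (degree (p \<beta>)) = (exp ((\<beta> - \<beta>0) * of_real c) - 1) * lead_coeff (p \<beta>)"
        by (simp add: q_def algebra_simps degree_pcompose)
      also have "\<dots> \<noteq> 0" using c(2)[OF that] less.prems(3)[OF that(1)] by simp
      finally show "q \<beta> \<noteq> 0" by auto
      show "degree (q \<beta>) \<le> degree (p \<beta>)" unfolding q_def
        by (intro degree_diff_le order.trans[OF degree_smult_le]) (auto simp: degree_pcompose)
    qed
    have q0: "q \<beta>0 = pcompose (p \<beta>0) [:of_real c, 1:] - p \<beta>0"
      by (simp add: q_def)
    have split: "(\<Sum>\<beta>\<in>B. f \<beta>) = f \<beta>0 + (\<Sum>\<beta>\<in>B - {\<beta>0}. f \<beta>)" for f :: "complex \<Rightarrow> 'a::comm_monoid_add"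
      using less.prems(1) \<beta>0 by (rule sum.remove)
    have le: "(\<Sum>\<beta>\<in>B - {\<beta>0}. degree (q \<beta>) + 1) \<le> (\<Sum>\<beta>\<in>B - {\<beta>0}. degree (p \<beta>) + 1)"
      using q_other by (intro sum_mono) auto
    show False
    proof (cases "degree (p \<beta>0) = 0")
      case False
      then have "q \<beta>0 \<noteq> 0" "degree (q \<beta>0) < degree (p \<beta>0)"
        using degree_shift_diff_less[of "p \<beta>0" "of_real c"] c(1) by (auto simp: q0)
      then show False
        using less.hyps[of q B] less.prems q_other limq le split[of "\<lambda>\<beta>. degree (p \<beta>) + 1"]
          split[of "\<lambda>\<beta>. degree (q \<beta>) + 1"]
        by force
    next
      case True
      then obtain a where a: "p \<beta>0 = [:a:]" by (metis degree_eq_zeroE)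
      with less.prems(3)[OF \<beta>0] have "a \<noteq> 0" by auto
      show False
      proof (cases "B = {\<beta>0}")
        case True
        have "norm (exp_poly B p (of_real s) * of_real (exp (- \<sigma> * s))) = norm a" for s
          using less.prems(4)[OF \<beta>0] by (simp add: True exp_poly_def a norm_mult flip: exp_add)
        with tendsto_norm[OF lim] have "((\<lambda>s::real. norm a) \<longlongrightarrow> norm (0::complex)) at_top" by (simp only:)
        with \<open>a \<noteq> 0\<close> show False by (simp add: tendsto_const_iff)
      next
        case False
        have "q \<beta>0 = 0" by (simp add: q0 a)
        then have "exp_poly B q s = exp_poly (B - {\<beta>0}) q s" for s
          unfolding exp_poly_def by (subst split) auto
        with limq have lim': "((\<lambda>s. exp_poly (B - {\<beta>0}) q (of_real s) * of_real (exp (- \<sigma> * s))) \<longlongrightarrow> 0) at_top"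
          by simp
        have "(\<Sum>\<beta>\<in>B - {\<beta>0}. degree (q \<beta>) + 1) < (\<Sum>\<beta>\<in>B. degree (p \<beta>) + 1)"
          using le split[of "\<lambda>\<beta>. degree (p \<beta>) + 1"] by simp
        moreover have "B - {\<beta>0} \<noteq> {}" using False \<beta>0 by auto
        ultimately show False
          using less.hyps[of q "B - {\<beta>0}"] less.prems q_other lim' by auto
      qed
    qed
  qed
qed

section \<open>Averages and antiderivatives\<close>

abbreviation growth :: "real \<Rightarrow> real \<Rightarrow> complex" where
  "growth \<sigma> t \<equiv> complex_of_real (t powr \<sigma>)"

text \<open>
The principle behind all computations of means below: an expansion of \<open>u\<close> near infinity with error
\<open>o(t powr \<sigma>)\<close> may be integrated term by term. The behaviour of \<open>u\<close> on a bounded interval contributes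
\<open>O(1/t)\<close> to the mean, which is admissible as \<open>\<sigma> \<ge> 0\<close>. The comparison function \<open>v\<close> is only needed beyond \<open>T\<close>,
so it may be singular near \<open>0\<close>.
\<close>

lemma cesaro_mean_asymp:
  assumes u: "\<And>t. t \<ge> 0 \<Longrightarrow> u integrable_on {0..t}"
    and T: "T > 0" and \<sigma>: "\<sigma> \<ge> 0"
    and v: "\<And>a b. T \<le> a \<Longrightarrow> a \<le> b \<Longrightarrow> (v has_integral (V b - V a)) {a..b}"
    and uv: "(\<lambda>t. u t - v t) \<in> o[at_top](growth \<sigma>)"
  shows "(\<lambda>t. cesaro_mean u t - V t / of_real t) \<in> o[at_top](growth \<sigma>)"
proof (rule landau_o.smallI)
  fix c :: real assume c: "c > 0"
  from landau_o.smallD[OF uv, of "c / 2"] c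
  obtain T0 where T0: "\<And>t. t \<ge> T0 \<Longrightarrow> norm (u t - v t) \<le> c / 2 * t powr \<sigma>"
    unfolding eventually_at_top_linorder by auto
  define T1 where "T1 = max T T0"
  define K where "K = integral {0..T1} u - V T1"
  have T1: "T1 > 0" "T1 \<ge> T" "T1 \<ge> T0" using T by (auto simp: T1_def)
  have "((\<lambda>t. norm K / t powr (\<sigma> + 1)) \<longlongrightarrow> 0) at_top"
    by (rule real_tendsto_divide_at_top[OF tendsto_const]) (use \<sigma> in real_asymp)
  then have ev: "eventually (\<lambda>t. norm K / t powr (\<sigma> + 1) < c / 2) at_top"
    using c by (intro order_tendstoD) auto
  show "eventually (\<lambda>t. norm (cesaro_mean u t - V t / of_real t) \<le> c * norm (growth \<sigma> t)) at_top"
    using ev eventually_ge_at_top[of T1]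
  proof eventually_elim
    case (elim t)
    have t: "t > 0" using elim T1 by simp
    have iu: "u integrable_on {T1..t}"
      by (rule integrable_subinterval_real[OF u[of t]]) (use t T1 in auto)
    have hv: "(v has_integral (V t - V T1)) {T1..t}"
      using v[of T1 t] T1 elim by auto
    have comb: "integral {0..t} u = integral {0..T1} u + integral {T1..t} u"
      using Henstock_Kurzweil_Integration.integral_combine[of 0 T1 t u] u[of t] T1 elim by auto
    have "integral {T1..t} (\<lambda>x. u x - v x) = integral {T1..t} u - (V t - V T1)"
      using integral_diff[OF iu has_integral_integrable[OF hv]] integral_unique[OF hv] by simp
    then have split: "integral {0..t} u - V t = K + integral {T1..t} (\<lambda>x. u x - v x)"
      by (simp add: comb K_def)
    have ie: "(\<lambda>x. u x - v x) integrable_on {T1..t}"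
      by (intro integrable_diff iu has_integral_integrable[OF hv])
    have "norm (integral {T1..t} (\<lambda>x. u x - v x)) \<le> (c / 2 * t powr \<sigma>) * Sigma_Algebra.measure lborel {T1..t}"
    proof (rule has_integral_bound_real[OF _ _ integrable_integral[OF ie]])
      show "norm (u x - v x) \<le> c / 2 * t powr \<sigma>" if "x \<in> {T1..t} - {}" for x
      proof -
        have "norm (u x - v x) \<le> c / 2 * x powr \<sigma>" using that T1 by (intro T0) auto
        also have "\<dots> \<le> c / 2 * t powr \<sigma>"
          using that T1 c \<sigma> by (intro mult_left_mono powr_mono2) auto
        finally show ?thesis .
      qed
    qed (use c in auto)
    also have "\<dots> \<le> c / 2 * t powr \<sigma> * t"
      using T1 c elim by (intro mult_left_mono) auto
    finally have b: "norm (integral {0..t} u - V t) \<le> norm K + c / 2 * t powr \<sigma> * t"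
      unfolding split by (intro order.trans[OF norm_triangle_ineq]) auto
    have "norm K \<le> c / 2 * t powr (\<sigma> + 1)"
      using elim t by (simp add: field_simps)
    also have "\<dots> = c / 2 * t powr \<sigma> * t"
      using t by (simp add: powr_add)
    finally have "norm (integral {0..t} u - V t) \<le> c * t powr \<sigma> * t"
      using b by simp
    then have "norm ((integral {0..t} u - V t) / of_real t) \<le> c * t powr \<sigma>"
      using t by (simp add: norm_divide field_simps)
    then show ?case
      by (simp add: cesaro_mean_def diff_divide_distrib)
  qed
qed

text \<open>
Averaging \<open>p (ln t) t powr \<beta>\<close> amounts to solving this equation with \<open>c = 1 + \<beta>\<close>. A zero solution forces
\<open>p = 0\<close>, so no term with \<open>\<beta> \<noteq> -1\<close> can be averaged away.
\<close>

lemma exists_poly_mean: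
  fixes p :: "complex poly"
  assumes "c \<noteq> 0"
  shows "\<exists>q. smult c q + pderiv q = p"
proof (induction "degree p" arbitrary: p rule: less_induct)
  case less
  show ?case
  proof (cases "degree p = 0")
    case True
    then obtain a where "p = [:a:]" by (metis degree_eq_zeroE)
    then show ?thesis using assms
      by (intro exI[of _ "[:a / c:]"]) (auto simp: pderiv_pCons)
  next
    case False
    then obtain r where r: "smult c r + pderiv r = pderiv p"
      using less[of "pderiv p"] by (auto simp: degree_pderiv)
    show ?thesis
    proof (intro exI)
      show "smult c (smult (1 / c) (p - r)) + pderiv (smult (1 / c) (p - r)) = p"
        using assms by (simp add: pderiv_smult pderiv_diff flip: r)
    qed
  qed
qed

lemma exp_poly_antiderivative:
  assumes "t > 0" "\<And>\<beta>. \<beta> \<in> B \<Longrightarrow> smult (1 + \<beta>) (q \<beta>) + pderiv (q \<beta>) = p \<beta>"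
  shows "((\<lambda>t. of_real t * exp_poly B q (of_real (ln t))) has_vector_derivative
            exp_poly B p (of_real (ln t))) (at t)"
proof -
  have d: "((\<lambda>t. complex_of_real (ln t)) has_vector_derivative of_real (1 / t)) (at t)"
    using assms(1) by (intro has_vector_derivative_of_real) (auto intro!: derivative_eq_intros simp: has_real_derivative_iff_has_vector_derivative[symmetric])
  have e: "((\<lambda>s. poly (q \<beta>) s * exp (\<beta> * s)) has_field_derivative
      (poly (pderiv (q \<beta>)) s + \<beta> * poly (q \<beta>) s) * exp (\<beta> * s)) (at s)" for \<beta> s
    by (auto intro!: derivative_eq_intros simp: algebra_simps)
  have f: "(exp_poly B q has_field_derivative
      (\<Sum>\<beta>\<in>B. (poly (pderiv (q \<beta>)) s + \<beta> * poly (q \<beta>) s) * exp (\<beta> * s))) (at s)" for s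
    unfolding exp_poly_def[abs_def] by (intro DERIV_sum e)
  have g: "((\<lambda>t. exp_poly B q (of_real (ln t))) has_vector_derivative of_real (1 / t) *
      (\<Sum>\<beta>\<in>B. (poly (pderiv (q \<beta>)) (of_real (ln t)) + \<beta> * poly (q \<beta>) (of_real (ln t))) * exp (\<beta> * of_real (ln t)))) (at t)"
    using field_vector_diff_chain_at[OF d f] by (simp add: o_def)
  have h: "((\<lambda>t. complex_of_real t) has_vector_derivative 1) (at t)"
    using has_vector_derivative_of_real[OF DERIV_ident[of "at t"]] by simp
  have "poly (p \<beta>) s = poly (q \<beta>) s + (poly (pderiv (q \<beta>)) s + \<beta> * poly (q \<beta>) s)" if "\<beta> \<in> B" for \<beta> s
    using arg_cong[OF assms(2)[OF that], of "\<lambda>p. poly p s"] by (simp add: algebra_simps)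
  then have "exp_poly B p s = exp_poly B q s +
      (\<Sum>\<beta>\<in>B. (poly (pderiv (q \<beta>)) s + \<beta> * poly (q \<beta>) s) * exp (\<beta> * s))" for s
    unfolding exp_poly_def sum.distrib[symmetric] by (intro sum.cong) (auto simp: algebra_simps)
  with has_vector_derivative_mult[OF h g] assms(1) show ?thesis
    by (simp add: algebra_simps)
qed

text \<open>
The periodic, bounded and continuous antiderivative of \<open>1/2 - frac t\<close>.
\<close>

definition sawtooth_integral :: "real \<Rightarrow> real" where
  "sawtooth_integral t = frac t * (1 - frac t) / 2"

lemma sawtooth_integral_bounds: "0 \<le> sawtooth_integral t" "sawtooth_integral t \<le> 1"
proof -
  have f: "0 \<le> frac t" "frac t < 1" by (auto simp: frac_lt_1)
  then show "0 \<le> sawtooth_integral t" by (simp add: sawtooth_integral_def)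
  have "frac t * (1 - frac t) \<le> 1 * 1" using f by (intro mult_mono) auto
  then show "sawtooth_integral t \<le> 1" by (simp add: sawtooth_integral_def)
qed

lemma isCont_sawtooth_integral: "isCont sawtooth_integral x"
proof (cases "x \<in> \<int>")
  case False
  then show ?thesis
    unfolding sawtooth_integral_def using continuous_frac[OF False]
    by (intro continuous_intros) auto
next
  case True
  have "norm (sawtooth_integral y) \<le> \<bar>y - x\<bar>" for y
  proof -
    have f: "0 \<le> frac y" "frac y < 1" by (auto simp: frac_lt_1)
    have "frac y \<le> \<bar>y - x\<bar> \<or> 1 - frac y \<le> \<bar>y - x\<bar>"
    proof -
      obtain n where "x = of_int n" using True by (auto elim: Ints_cases)
      then show ?thesis by (cases "n \<le> \<lfloor>y\<rfloor>") (unfold frac_def, linarith+)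
    qed
    moreover have "frac y * (1 - frac y) \<le> frac y" "frac y * (1 - frac y) \<le> 1 - frac y"
      using f by (simp_all add: mult_left_le mult_left_le_one_le)
    ultimately show ?thesis
      using sawtooth_integral_bounds[of y] by (auto simp: sawtooth_integral_def)
  qed
  moreover have "((\<lambda>y. \<bar>y - x\<bar>) \<longlongrightarrow> 0) (at x)"
    by (rule tendsto_eq_intros refl | simp)+
  ultimately have "(sawtooth_integral \<longlongrightarrow> 0) (at x)"
    by (intro Lim_null_comparison[of sawtooth_integral]) auto
  moreover have "sawtooth_integral x = 0"
    using True by (simp add: sawtooth_integral_def)
  ultimately show ?thesis by (simp add: isCont_def)
qed

text \<open>
The derivative of \<open>sawtooth_integral t * ln t\<close> away from the integers. It differs from the term
\<open>(1/2 - frac t) ln t\<close> of the partial sums by \<open>O(1/t)\<close>, and unlike that term it has an antiderivative in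
closed form.
\<close>

definition sawtooth_ln :: "real \<Rightarrow> real" where
  "sawtooth_ln t = (1 / 2 - frac t) * ln t + sawtooth_integral t / t"

lemma has_integral_sawtooth_ln:
  assumes "0 < a" "a \<le> b"
  shows "(sawtooth_ln has_integral (sawtooth_integral b * ln b - sawtooth_integral a * ln a)) {a..b}"
proof (rule fundamental_theorem_of_calculus_interior_strong)
  have "{a..b} \<inter> \<int> \<subseteq> of_int ` {\<lceil>a\<rceil>..\<lfloor>b\<rfloor>}"
    by (auto elim!: Ints_cases simp: ceiling_le_iff le_floor_iff)
  then show "finite ({a..b} \<inter> \<int>)" by (rule finite_subset) auto
  show "continuous_on {a..b} (\<lambda>x. sawtooth_integral x * ln x)"
    using assms isCont_sawtooth_integral
    by (intro continuous_intros continuous_at_imp_continuous_on) auto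
  fix x assume x: "x \<in> {a<..<b} - {a..b} \<inter> \<int>"
  then have "x \<notin> \<int>" "x > 0" using assms by auto
  have ev: "eventually (\<lambda>y. \<lfloor>y\<rfloor> = \<lfloor>x\<rfloor>) (nhds x)"
    by (rule eventually_floor_eq[OF filterlim_ident \<open>x \<notin> \<int>\<close>])
  define m where "m = real_of_int \<lfloor>x\<rfloor>"
  have "((\<lambda>y. (y - m) * (1 - (y - m)) / 2 * ln y) has_real_derivative
      (1 / 2 - (x - m)) * ln x + (x - m) * (1 - (x - m)) / 2 / x) (at x)"
    using \<open>x > 0\<close> by (auto intro!: derivative_eq_intros simp: field_simps)
  also have "?this \<longleftrightarrow> ((\<lambda>x. sawtooth_integral x * ln x) has_real_derivative sawtooth_ln x) (at x)"
    by (rule DERIV_cong_ev) 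
       (use ev in \<open>auto simp: sawtooth_ln_def sawtooth_integral_def frac_def m_def elim!: eventually_mono\<close>)
  finally show "((\<lambda>x. sawtooth_integral x * ln x) has_vector_derivative sawtooth_ln x) (at x)"
    by (simp add: has_real_derivative_iff_has_vector_derivative)
qed fact

section \<open>Cesaro means of power-logarithm expansions\<close>

lemma one_bigo_growth:
  assumes "\<sigma> \<ge> 0"
  shows "(\<lambda>_. 1) \<in> O[at_top](growth \<sigma>)"
proof (rule bigoI[of _ 1])
  show "eventually (\<lambda>t. norm (1::complex) \<le> 1 * norm (growth \<sigma> t)) at_top"
    using eventually_ge_at_top[of 1]
    by eventually_elim (use assms in \<open>auto simp: ge_one_powr_ge_zero\<close>)
qed

lemma sawtooth_integral_ln_smallo:
  "\<sigma> \<ge> 0 \<Longrightarrow> (\<lambda>t. of_real (sawtooth_integral t * ln t / t)) \<in> o[at_top](growth \<sigma>)"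
proof -
  assume \<sigma>: "\<sigma> \<ge> 0"
  have "((\<lambda>t. sawtooth_integral t * (ln t / t)) \<longlongrightarrow> 0) at_top"
  proof (rule Lim_null_comparison)
    show "eventually (\<lambda>t. norm (sawtooth_integral t * (ln t / t)) \<le> ln t / t) at_top"
      using eventually_ge_at_top[of 1]
    proof eventually_elim
      case (elim t)
      then have "sawtooth_integral t * (ln t / t) \<le> 1 * (ln t / t)"
        using sawtooth_integral_bounds by (intro mult_right_mono) auto
      then show ?case using elim sawtooth_integral_bounds[of t] by (simp add: abs_mult)
    qed
    show "((\<lambda>t::real. ln t / t) \<longlongrightarrow> 0) at_top" by real_asymp
  qed
  then have "(\<lambda>t. complex_of_real (sawtooth_integral t * ln t / t)) \<in> o[at_top](\<lambda>_. 1)"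
    by (intro smalloI_tendsto) (auto dest: tendsto_of_real[where 'a=complex])
  from this one_bigo_growth[OF \<sigma>] show ?thesis by (rule landau_o.small_big_trans)
qed

text \<open>
One averaging step. The sawtooth term disappears since its antiderivative is \<open>O(ln t)\<close>; the constant \<open>L\<close>,
the candidate for the limit, is kept apart because averaging fixes it.
\<close>

lemma cesaro_mean_expansion:
  assumes u: "\<And>t. t \<ge> 0 \<Longrightarrow> u integrable_on {0..t}" and \<sigma>: "\<sigma> \<ge> 0"
    and B: "\<And>\<beta>. \<beta> \<in> B \<Longrightarrow> \<beta> \<noteq> -1"
    and uv: "(\<lambda>t. u t - (L + exp_poly B p (of_real (ln t)) + \<kappa> * of_real (sawtooth_ln t))) \<in> o[at_top](growth \<sigma>)"
  shows "\<exists>q. (\<forall>\<beta>\<in>B. p \<beta> \<noteq> 0 \<longrightarrow> q \<beta> \<noteq> 0) \<and>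
    (\<lambda>t. cesaro_mean u t - (L + exp_poly B q (of_real (ln t)))) \<in> o[at_top](growth \<sigma>)"
proof -
  have "\<forall>\<beta>. \<exists>q. \<beta> \<in> B \<longrightarrow> smult (1 + \<beta>) q + pderiv q = p \<beta>"
    using B exists_poly_mean by (metis add.inverse_unique)
  then obtain q where q: "\<And>\<beta>. \<beta> \<in> B \<Longrightarrow> smult (1 + \<beta>) (q \<beta>) + pderiv (q \<beta>) = p \<beta>"
    by metis
  define V where "V t = L * of_real t + of_real t * exp_poly B q (of_real (ln t))
      + \<kappa> * of_real (sawtooth_integral t * ln t)" for t
  have V: "((\<lambda>t. L + exp_poly B p (of_real (ln t)) + \<kappa> * of_real (sawtooth_ln t))
      has_integral (V b - V a)) {a..b}" if ab: "1 \<le> a" "a \<le> b" for a b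
  proof -
    have 1: "((\<lambda>t. L) has_integral (L * of_real b - L * of_real a)) {a..b}"
      using has_integral_const_real[of L a b] ab by (simp add: scaleR_conv_of_real algebra_simps)
    have 2: "((\<lambda>t. exp_poly B p (of_real (ln t))) has_integral
       (of_real b * exp_poly B q (of_real (ln b)) - of_real a * exp_poly B q (of_real (ln a)))) {a..b}"
      using ab q by (intro fundamental_theorem_of_calculus
          has_vector_derivative_at_within[OF exp_poly_antiderivative]) auto
    have 3: "((\<lambda>t. \<kappa> * of_real (sawtooth_ln t)) has_integral
       (\<kappa> * of_real (sawtooth_integral b * ln b - sawtooth_integral a * ln a))) {a..b}"
      using ab by (intro has_integral_mult_right has_integral_of_real has_integral_sawtooth_ln) auto
    from has_integral_add[OF has_integral_add[OF 1 2] 3] show ?thesis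
      by (simp add: V_def algebra_simps)
  qed
  have "(\<lambda>t. cesaro_mean u t - V t / of_real t) \<in> o[at_top](growth \<sigma>)"
    by (rule cesaro_mean_asymp[OF u _ \<sigma> V uv]) auto
  moreover have "(\<lambda>t. \<kappa> * of_real (sawtooth_integral t * ln t / t)) \<in> o[at_top](growth \<sigma>)"
  proof (cases "\<kappa> = 0")
    case False
    from landau_o.small.cmult_in_iff[THEN iffD2, OF False sawtooth_integral_ln_smallo[OF \<sigma>]] show ?thesis .
  qed simp
  ultimately have "(\<lambda>t. (cesaro_mean u t - V t / of_real t) +
      \<kappa> * of_real (sawtooth_integral t * ln t / t)) \<in> o[at_top](growth \<sigma>)"
    by (rule sum_in_smallo)
  also have "?this \<longleftrightarrow> (\<lambda>t. cesaro_mean u t - (L + exp_poly B q (of_real (ln t)))) \<in> o[at_top](growth \<sigma>)"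
    by (intro landau_o.small.in_cong eventually_mono[OF eventually_gt_at_top[of 0]])
       (auto simp: V_def field_simps)
  finally show ?thesis
  proof (intro exI[of _ q] conjI ballI impI)
    fix \<beta> assume "\<beta> \<in> B" "p \<beta> \<noteq> 0"
    then show "q \<beta> \<noteq> 0" using q[of \<beta>] by auto
  qed
qed

lemma cesaro_iterate_expansion:
  assumes u: "\<And>k t. k \<le> N \<Longrightarrow> t \<ge> 0 \<Longrightarrow> (cesaro_mean ^^ k) u integrable_on {0..t}" and \<sigma>: "\<sigma> \<ge> 0"
    and B: "\<And>\<beta>. \<beta> \<in> B \<Longrightarrow> \<beta> \<noteq> -1 \<and> p \<beta> \<noteq> 0"
    and uv: "(\<lambda>t. u t - (L + exp_poly B p (of_real (ln t)) + \<kappa> * of_real (sawtooth_ln t))) \<in> o[at_top](growth \<sigma>)"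
  shows "\<exists>q. (\<forall>\<beta>\<in>B. q \<beta> \<noteq> 0) \<and>
    (\<lambda>t. (cesaro_mean ^^ Suc N) u t - (L + exp_poly B q (of_real (ln t)))) \<in> o[at_top](growth \<sigma>)"
  using u
proof (induction N)
  case 0
  show ?case using cesaro_mean_expansion[OF 0[of 0, simplified] \<sigma> _ uv] B by force
next
  case (Suc N)
  then obtain q where q: "\<And>\<beta>. \<beta> \<in> B \<Longrightarrow> q \<beta> \<noteq> 0"
    "(\<lambda>t. (cesaro_mean ^^ Suc N) u t - (L + exp_poly B q (of_real (ln t)) + 0 * of_real (sawtooth_ln t))) \<in> o[at_top](growth \<sigma>)"
    by (auto simp del: funpow.simps)
  have int: "\<And>t. t \<ge> 0 \<Longrightarrow> (cesaro_mean ^^ Suc N) u integrable_on {0..t}"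
    using Suc.prems by blast
  show ?case
    using cesaro_mean_expansion[OF int \<sigma> _ q(2)] B q(1) by (subst funpow.simps) (force simp del: funpow.simps)
qed

text \<open>
Leading terms survive every averaging: if \<open>B\<close> were nonempty, the \<open>N\<close>-th mean minus \<open>L\<close> would be a nonzero
exponential polynomial in \<open>ln t\<close>, up to \<open>o(t powr \<sigma>)\<close>; as it tends to \<open>0\<close>, that polynomial would itself be
\<open>o(t powr \<sigma>)\<close>.
\<close>

lemma no_leading_terms_if_cesaro_limit:
  assumes u: "\<And>k t. k < N \<Longrightarrow> t \<ge> 0 \<Longrightarrow> (cesaro_mean ^^ k) u integrable_on {0..t}" and \<sigma>: "\<sigma> \<ge> 0"
    and N: "N > 0" and lim: "((cesaro_mean ^^ N) u \<longlongrightarrow> L) at_top"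
    and B: "finite B" "\<And>\<beta>. \<beta> \<in> B \<Longrightarrow> Re \<beta> = \<sigma> \<and> p \<beta> \<noteq> 0"
    and uv: "(\<lambda>t. u t - (L + exp_poly B p (of_real (ln t)) + \<kappa> * of_real (sawtooth_ln t))) \<in> o[at_top](growth \<sigma>)"
  shows "B = {}"
proof (rule ccontr)
  assume ne: "B \<noteq> {}"
  obtain M where M: "N = Suc M" using N by (cases N) auto
  have B': "\<beta> \<noteq> -1 \<and> p \<beta> \<noteq> 0" if "\<beta> \<in> B" for \<beta>
    using B(2)[OF that] \<sigma> by auto
  have "\<exists>q. (\<forall>\<beta>\<in>B. q \<beta> \<noteq> 0) \<and>
    (\<lambda>t. (cesaro_mean ^^ Suc M) u t - (L + exp_poly B q (of_real (ln t)))) \<in> o[at_top](growth \<sigma>)"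
    by (rule cesaro_iterate_expansion[OF _ \<sigma> _ uv]) (use u M B' in \<open>auto simp del: funpow.simps\<close>)
  then obtain q where q: "\<And>\<beta>. \<beta> \<in> B \<Longrightarrow> q \<beta> \<noteq> 0"
    and a: "(\<lambda>t. (cesaro_mean ^^ N) u t - (L + exp_poly B q (of_real (ln t)))) \<in> o[at_top](growth \<sigma>)"
    unfolding M by auto
  have "(\<lambda>t. (cesaro_mean ^^ N) u t - L) \<in> o[at_top](\<lambda>_. 1)"
    using lim by (intro smalloI_tendsto) (auto simp: LIM_zero_iff)
  from this one_bigo_growth[OF \<sigma>] have "(\<lambda>t. (cesaro_mean ^^ N) u t - L) \<in> o[at_top](growth \<sigma>)"
    by (rule landau_o.small_big_trans)
  from sum_in_smallo(2)[OF this a] have "(\<lambda>t. exp_poly B q (of_real (ln t))) \<in> o[at_top](growth \<sigma>)"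
    by simp
  from smalloD_tendsto[OF this]
  have "((\<lambda>t. exp_poly B q (of_real (ln t)) / growth \<sigma> t) \<longlongrightarrow> 0) at_top" .
  then have "((\<lambda>s. exp_poly B q (of_real (ln (exp s))) / growth \<sigma> (exp s)) \<longlongrightarrow> 0) at_top"
    by (rule filterlim_compose) (rule exp_at_top)
  then have "((\<lambda>s. exp_poly B q (of_real s) * of_real (exp (- \<sigma> * s))) \<longlongrightarrow> 0) at_top"
    by (simp add: powr_def exp_minus field_simps)
  with exp_poly_not_negligible[of B q \<sigma>] B q ne show False by auto
qed

section \<open>Passing from the shifted to the unshifted variable\<close>

text \<open>
The errors made in replacing \<open>ln \<gamma>\<close> by \<open>ln t\<close> get multiplied by arbitrary polynomials in \<open>ln t\<close>, so they must
stay negligible under such multiplications.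
\<close>

definition ln_negligible :: "(real \<Rightarrow> complex) \<Rightarrow> bool" where
  "ln_negligible f \<longleftrightarrow> (\<forall>k. ((\<lambda>t. of_real (ln t) ^ k * f t) \<longlongrightarrow> 0) at_top)"

lemma ln_negligible_tendsto: "ln_negligible f \<Longrightarrow> (f \<longlongrightarrow> 0) at_top"
  unfolding ln_negligible_def by (drule spec[of _ 0]) simp

lemma ln_negligible_add: "ln_negligible f \<Longrightarrow> ln_negligible g \<Longrightarrow> ln_negligible (\<lambda>t. f t + g t)"
  unfolding ln_negligible_def distrib_left by (intro allI tendsto_add_zero) auto

lemma ln_negligible_ln: "ln_negligible f \<Longrightarrow> ln_negligible (\<lambda>t. of_real (ln t) * f t)"
  unfolding ln_negligible_def mult.assoc[symmetric] power_Suc2[symmetric] by blast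

lemma ln_negligible_bounded:
  assumes f: "ln_negligible f" and le: "eventually (\<lambda>t. norm (g t) \<le> c * norm (f t)) at_top"
  shows "ln_negligible g"
  unfolding ln_negligible_def
proof
  fix k
  have "((\<lambda>t. of_real c * (of_real (ln t) ^ k * f t)) \<longlongrightarrow> 0) at_top"
    using f unfolding ln_negligible_def by (intro tendsto_mult_right_zero) auto
  then have "((\<lambda>t. norm (of_real c * (of_real (ln t) ^ k * f t))) \<longlongrightarrow> 0) at_top"
    by (simp only: tendsto_norm_zero)
  then show "((\<lambda>t. of_real (ln t) ^ k * g t) \<longlongrightarrow> 0) at_top"
  proof (rule Lim_null_comparison[rotated])
    show "eventually (\<lambda>t. norm (of_real (ln t) ^ k * g t) \<le> norm (of_real c * (of_real (ln t) ^ k * f t))) at_top"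
      using le
    proof eventually_elim
      case (elim t)
      then have "norm (g t) \<le> \<bar>c\<bar> * norm (f t)"
        by (rule order.trans) (intro mult_right_mono, auto)
      then have "norm (of_real (ln t) ^ k :: complex) * norm (g t) \<le> norm (of_real (ln t) ^ k :: complex) * (\<bar>c\<bar> * norm (f t))"
        by (intro mult_left_mono) auto
      then show ?case by (simp add: norm_mult mult_ac)
    qed
  qed
qed

lemma ln_negligible_mult_null:
  assumes "ln_negligible f" "(g \<longlongrightarrow> 0) at_top"
  shows "ln_negligible (\<lambda>t. f t * g t)"
proof (rule ln_negligible_bounded[OF assms(1)])
  have "eventually (\<lambda>t. norm (g t) < 1) at_top"
    using tendsto_norm_zero[OF assms(2)] by (rule order_tendstoD) simp
  then show "eventually (\<lambda>t. norm (f t * g t) \<le> 1 * norm (f t)) at_top"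
    by eventually_elim (simp add: norm_mult mult_left_le)
qed

lemma ln_negligible_poly:
  assumes "ln_negligible f"
  shows "ln_negligible (\<lambda>t. poly p (of_real (ln t)) * f t)"
proof (induction p)
  case 0
  show ?case by (simp add: ln_negligible_def)
next
  case (pCons a p)
  have "ln_negligible (\<lambda>t. a * f t)"
    by (rule ln_negligible_bounded[OF assms, of _ "norm a"]) (simp add: norm_mult)
  from ln_negligible_add[OF this ln_negligible_ln[OF pCons.IH]] show ?case
    by (simp add: algebra_simps)
qed

text \<open>
Horner recursion: for \<open>q x = a + x p x\<close> the difference is
\<open>s (p (s + d) - p s) + d (p (s + d) - p s) + d p s\<close>, where \<open>s = ln t\<close>.
\<close>

lemma ln_negligible_poly_shift:
  assumes "ln_negligible d"
  shows "ln_negligible (\<lambda>t. poly p (of_real (ln t) + d t) - poly p (of_real (ln t)))"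
proof (induction p)
  case 0
  show ?case by (simp add: ln_negligible_def)
next
  case (pCons a p)
  note IH = pCons.IH
  have "ln_negligible (\<lambda>t. of_real (ln t) * (poly p (of_real (ln t) + d t) - poly p (of_real (ln t)))
    + ((poly p (of_real (ln t) + d t) - poly p (of_real (ln t))) * d t + poly p (of_real (ln t)) * d t))"
    by (intro ln_negligible_add ln_negligible_ln IH ln_negligible_poly[OF assms]
        ln_negligible_mult_null[OF IH ln_negligible_tendsto[OF assms]])
  then show ?case by (simp add: algebra_simps)
qed

lemma ln_negligible_exp_shift:
  assumes "ln_negligible d"
  shows "ln_negligible (\<lambda>t. exp (\<beta> * d t) - 1)"
proof (rule ln_negligible_bounded[OF assms])
  have "((\<lambda>t. norm (\<beta> * d t)) \<longlongrightarrow> 0) at_top"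
    by (intro tendsto_norm_zero tendsto_mult_right_zero ln_negligible_tendsto[OF assms])
  then have "eventually (\<lambda>t. norm (\<beta> * d t) < 1) at_top"
    by (rule order_tendstoD) simp
  then show "eventually (\<lambda>t. norm (exp (\<beta> * d t) - 1) \<le> (exp 1 * norm \<beta>) * norm (d t)) at_top"
  proof eventually_elim
    case (elim t)
    have "norm (exp (\<beta> * d t) - 1) \<le> exp \<bar>Re (\<beta> * d t)\<bar> * norm (\<beta> * d t)"
      using Taylor_exp[of "\<beta> * d t" 0] by simp
    also have "\<dots> \<le> exp 1 * norm (\<beta> * d t)"
      using elim abs_Re_le_cmod[of "\<beta> * d t"] by (intro mult_right_mono) auto
    finally show ?case by (simp add: norm_mult)
  qed
qed

lemma ln_negligible_powr:
  assumes "Re \<beta> < \<sigma>"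
  shows "ln_negligible (\<lambda>t. exp (\<beta> * of_real (ln t)) / growth \<sigma> t)"
  unfolding ln_negligible_def
proof
  fix k
  have "((\<lambda>t. ln t ^ k * t powr (Re \<beta> - \<sigma>)) \<longlongrightarrow> 0) at_top"
    using assms by real_asymp
  then show "((\<lambda>t. of_real (ln t) ^ k * (exp (\<beta> * of_real (ln t)) / growth \<sigma> t)) \<longlongrightarrow> 0) at_top"
  proof (rule Lim_null_comparison[rotated])
    show "eventually (\<lambda>t. norm (of_real (ln t) ^ k * (exp (\<beta> * of_real (ln t)) / growth \<sigma> t))
        \<le> ln t ^ k * t powr (Re \<beta> - \<sigma>)) at_top"
      using eventually_ge_at_top[of 1]
      by eventually_elim (simp add: norm_mult norm_divide norm_power powr_diff powr_def[of _ "Re \<beta>"])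
  qed
qed

lemma Ln_shift:
  assumes "t > norm z0"
  shows "z0 + of_real t \<noteq> 0" "1 + z0 / of_real t \<noteq> 0"
    "Ln (z0 + of_real t) = of_real (ln t) + Ln (1 + z0 / of_real t)"
proof -
  have t: "t > 0" using assms norm_ge_zero[of z0] by linarith
  show *: "z0 + of_real t \<noteq> 0"
  proof
    assume "z0 + of_real t = 0"
    then have "z0 = - of_real t" by (simp add: add_eq_0_iff2)
    then show False using assms t by simp
  qed
  have eq: "z0 + of_real t = of_real t * (1 + z0 / of_real t)"
    using t by (simp add: field_simps)
  show "1 + z0 / of_real t \<noteq> 0" using * eq by auto
  then show "Ln (z0 + of_real t) = of_real (ln t) + Ln (1 + z0 / of_real t)"
    unfolding eq using t by (simp add: Ln_times_of_real Ln_of_real)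
qed

lemma Ln_shift_asymp: "((\<lambda>t. of_real t * Ln (1 + z0 / of_real t)) \<longlongrightarrow> z0) at_top"
proof -
  have "((\<lambda>t. (norm z0)\<^sup>2 / t / (1 - norm z0 / t)) \<longlongrightarrow> 0) at_top"
    by real_asymp
  then have "((\<lambda>t. of_real t * Ln (1 + z0 / of_real t) - z0) \<longlongrightarrow> 0) at_top"
  proof (rule Lim_null_comparison[rotated])
    show "eventually (\<lambda>t. norm (of_real t * Ln (1 + z0 / of_real t) - z0)
        \<le> (norm z0)\<^sup>2 / t / (1 - norm z0 / t)) at_top"
      using eventually_gt_at_top[of "norm z0"]
    proof eventually_elim
      case (elim t)
      have t: "t > 0" using elim norm_ge_zero[of z0] by linarith
      have "of_real t * Ln (1 + z0 / of_real t) - z0 = of_real t * (Ln (1 + z0 / of_real t) - z0 / of_real t)"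
        using t by (simp add: field_simps)
      also have "norm \<dots> \<le> t * ((norm (z0 / of_real t))\<^sup>2 / (1 - norm (z0 / of_real t)))"
      proof -
        have "norm (z0 / of_real t) < 1" using t elim by (simp add: norm_divide)
        from mult_left_mono[OF Ln_approx_linear[OF this], of t] show ?thesis
          using t by (simp add: norm_mult)
      qed
      also have "\<dots> = (norm z0)\<^sup>2 / t / (1 - norm z0 / t)"
        using t by (simp add: norm_divide power2_eq_square)
      finally show ?case .
    qed
  qed
  then show ?thesis by (simp add: LIM_zero_iff)
qed

lemma ln_negligible_Ln_shift: "ln_negligible (\<lambda>t. Ln (1 + z0 / of_real t))"
  unfolding ln_negligible_def
proof
  fix k
  have "((\<lambda>t::real. ln t ^ k * t powr (-1)) \<longlongrightarrow> 0) at_top" by real_asymp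
  then have "((\<lambda>t. complex_of_real (ln t ^ k * t powr (-1))) \<longlongrightarrow> of_real 0) at_top"
    by (rule tendsto_of_real)
  from tendsto_mult[OF this Ln_shift_asymp[of z0]]
  have "((\<lambda>t. of_real (ln t ^ k * t powr (-1)) * (of_real t * Ln (1 + z0 / of_real t))) \<longlongrightarrow> 0) at_top"
    by simp
  then show "((\<lambda>t. of_real (ln t) ^ k * Ln (1 + z0 / of_real t)) \<longlongrightarrow> 0) at_top"
    by (rule Lim_transform_eventually)
       (use eventually_gt_at_top[of "0::real"] in \<open>eventually_elim, simp add: powr_minus\<close>)
qed

lemma exp_poly_term_shift:
  "(\<lambda>t. poly p (Ln (z0 + of_real t)) * exp (\<beta> * Ln (z0 + of_real t))
      - poly p (of_real (ln t)) * exp (\<beta> * of_real (ln t))) \<in> o[at_top](growth (Re \<beta>))"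
proof -
  define d where "d t = Ln (1 + z0 / of_real t)" for t
  have d: "ln_negligible d"
    using ln_negligible_Ln_shift unfolding d_def[abs_def] .
  note E = ln_negligible_exp_shift[OF d, of \<beta>] and P = ln_negligible_poly_shift[OF d, of p]
  define h where "h t = (poly p (of_real (ln t) + d t) - poly p (of_real (ln t))) * (exp (\<beta> * d t) - 1)
     + ((poly p (of_real (ln t) + d t) - poly p (of_real (ln t)))
     + poly p (of_real (ln t)) * (exp (\<beta> * d t) - 1))" for t
  have "ln_negligible h"
    unfolding h_def
    by (intro ln_negligible_add P ln_negligible_poly E
        ln_negligible_mult_null[OF P ln_negligible_tendsto[OF E]])
  then have "(h \<longlongrightarrow> 0) at_top" by (rule ln_negligible_tendsto)
  then have h: "h \<in> o[at_top](\<lambda>_. 1)" by (intro smalloI_tendsto) auto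
  have "(\<lambda>t. exp (\<beta> * of_real (ln t))) \<in> O[at_top](growth (Re \<beta>))"
    by (rule bigoI[of _ 1], rule eventually_mono[OF eventually_gt_at_top[of 0]]) (simp add: powr_def)
  from landau_o.small_big_mult[OF h this]
  have "(\<lambda>t. h t * exp (\<beta> * of_real (ln t))) \<in> o[at_top](growth (Re \<beta>))" by simp
  also have "?this \<longleftrightarrow> ?thesis"
    using eventually_gt_at_top[of "norm z0"]
    by (intro landau_o.small.in_cong, eventually_elim)
       (simp add: Ln_shift h_def d_def distrib_left exp_add algebra_simps)
  finally show ?thesis .
qed

lemma exp_poly_term_small:
  assumes "Re \<beta> < \<sigma>"
  shows "(\<lambda>t. poly p (of_real (ln t)) * exp (\<beta> * of_real (ln t))) \<in> o[at_top](growth \<sigma>)"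
proof (rule smalloI_tendsto)
  show "((\<lambda>t. poly p (of_real (ln t)) * exp (\<beta> * of_real (ln t)) / growth \<sigma> t) \<longlongrightarrow> 0) at_top"
    using ln_negligible_tendsto[OF ln_negligible_poly[OF ln_negligible_powr[OF assms]], of p] by simp
  show "eventually (\<lambda>t. growth \<sigma> t \<noteq> 0) at_top"
    using eventually_gt_at_top[of 0] by eventually_elim simp
qed

lemma growth_mono:
  assumes "a \<le> b" shows "growth a \<in> O[at_top](growth b)"
  by (rule bigoI[of _ 1], rule eventually_mono[OF eventually_ge_at_top[of 1]])
     (use assms in \<open>auto intro: powr_mono\<close>)

text \<open>
This is where terms with different real parts of the exponent are separated: the shift changes a term of size
\<open>t powr Re \<beta>\<close> only by \<open>o(t powr Re \<beta>)\<close>, and everything below \<open>\<sigma>\<close> goes into the error.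
\<close>

lemma exp_poly_leading_part:
  assumes "finite B" "\<And>\<beta>. \<beta> \<in> B \<Longrightarrow> Re \<beta> \<le> \<sigma>"
  shows "(\<lambda>t. exp_poly B p (Ln (z0 + of_real t)) - exp_poly {\<beta> \<in> B. Re \<beta> = \<sigma>} p (of_real (ln t)))
     \<in> o[at_top](growth \<sigma>)"
proof -
  define T where "T \<beta> t = poly (p \<beta>) (Ln (z0 + of_real t)) * exp (\<beta> * Ln (z0 + of_real t)) -
     (if Re \<beta> = \<sigma> then poly (p \<beta>) (of_real (ln t)) * exp (\<beta> * of_real (ln t)) else 0)" for \<beta> t
  have "T \<beta> \<in> o[at_top](growth \<sigma>)" if "\<beta> \<in> B" for \<beta>
  proof (cases "Re \<beta> = \<sigma>")
    case True
    then show ?thesis using exp_poly_term_shift[of "p \<beta>" z0 \<beta>] by (simp add: T_def[abs_def])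
  next
    case False
    with assms(2)[OF that] have lt: "Re \<beta> < \<sigma>" by simp
    from sum_in_smallo(1)[OF landau_o.small_big_trans[OF exp_poly_term_shift[of "p \<beta>" z0 \<beta>] growth_mono]
        exp_poly_term_small[OF lt, of "p \<beta>"]] lt False
    show ?thesis by (simp add: T_def[abs_def])
  qed
  then have "(\<lambda>t. \<Sum>\<beta>\<in>B. T \<beta> t) \<in> o[at_top](growth \<sigma>)"
    by (rule big_sum_in_smallo)
  also have "(\<lambda>t. \<Sum>\<beta>\<in>B. T \<beta> t) = (\<lambda>t. exp_poly B p (Ln (z0 + of_real t)) -
      exp_poly {\<beta> \<in> B. Re \<beta> = \<sigma>} p (of_real (ln t)))"
    unfolding T_def exp_poly_def sum_subtractf
    using assms(1) by (simp add: sum.inter_filter)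
  finally show ?thesis .
qed

section \<open>Asymptotics of the partial sums of the logarithm\<close>

text \<open>
Only the existence of the limit matters, because the constant cancels in the Gamma function. The increments
of the sequence are \<open>O(1/n^2)\<close>.
\<close>

lemma Stirling_constant_exists:
  "\<exists>c::real. (\<lambda>n. ln (fact n) - ((real n + 1/2) * ln (real n) - real n)) \<longlonglongrightarrow> c"
proof -
  define a where "a n = ln (fact (Suc n)) - ((real (Suc n) + 1/2) * ln (real (Suc n)) - real (Suc n))" for n
  have step: "a (Suc n) - a n = - ((real n + 3/2) * ln (1 + 1 / (real n + 1)) - 1)" for n
  proof -
    have "ln (1 + 1 / (real n + 1)) = ln ((real n + 2) / (real n + 1))"
      by (simp add: field_simps)
    also have "\<dots> = ln (real n + 2) - ln (real n + 1)" by (simp add: ln_div)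
    finally have 1: "ln (1 + 1 / (real n + 1)) = ln (real n + 2) - ln (real n + 1)" .
    have 2: "ln (fact (Suc (Suc n)) :: real) = ln (real n + 2) + ln (fact (Suc n))"
      by (subst fact_Suc, subst ln_mult) (auto simp: add_ac)
    show ?thesis unfolding a_def 1 2 by (simp add: algebra_simps)
  qed
  have "(\<lambda>n::nat. (real n + 3/2) * ln (1 + 1 / (real n + 1)) - 1) \<in> O(\<lambda>n. 1 / real n ^ 2)"
    by real_asymp
  then have "summable (\<lambda>n::nat. (real n + 3/2) * ln (1 + 1 / (real n + 1)) - 1)"
    by (rule summable_comparison_test_bigo[rotated])
       (use inverse_power_summable[of 2, where 'a=real] in \<open>simp add: inverse_eq_divide\<close>)
  then have "summable (\<lambda>n. a (Suc n) - a n)"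
    unfolding step by (rule summable_minus)
  from summable_LIMSEQ[OF this] have "(\<lambda>n. a n - a 0) \<longlonglongrightarrow> (\<Sum>n. a (Suc n) - a n)"
    by (simp add: sum_lessThan_telescope)
  from tendsto_add[OF this tendsto_const[of "a 0"]]
  have "a \<longlonglongrightarrow> (\<Sum>n. a (Suc n) - a n) + a 0" by simp
  then show ?thesis unfolding a_def by (intro exI) (rule LIMSEQ_imp_Suc)
qed

text \<open>
The constant by which the sum for \<open>z\<close> differs from the sum for \<open>0\<close>. The formula has a removable
singularity (modulo \<open>2 pi \<i>\<close>) at \<open>z = 0\<close>, whence the case distinction.
\<close>

definition ln_sum_offset :: "complex \<Rightarrow> complex" where
  "ln_sum_offset z = (if z = 0 then 0 else - Ln z - ln_Gamma z)"

lemma Ln_of_nat_eq: "n > 0 \<Longrightarrow> Ln (of_nat n) = of_real (ln (real n))"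
  using Ln_of_real[of "real n"] by simp

lemma sum_Ln_of_nat: "(\<Sum>k=1..n. Ln (of_nat k)) = of_real (ln (fact n))"
proof (induction n)
  case (Suc n)
  have "ln (fact (Suc n) :: real) = ln (real (Suc n)) + ln (fact n)"
    by (subst fact_Suc, subst ln_mult) auto
  then show ?case using Suc by (simp add: Ln_of_nat_eq del: of_nat_Suc fact_Suc)
qed simp

lemma not_nonpos_Int:
  assumes "z \<noteq> 0" "z \<notin> {of_int n | n :: int. n < 0}"
  shows "z \<notin> \<int>\<^sub>\<le>\<^sub>0"
proof
  assume "z \<in> \<int>\<^sub>\<le>\<^sub>0"
  then obtain n :: int where "z = of_int n" "n \<le> 0" by (auto elim!: nonpos_Ints_cases)
  with assms show False by (cases "n = 0") auto
qed

text \<open>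
Since \<open>k\<close> is a positive real, \<open>Ln (z + k) = Ln k + Ln (z/k + 1)\<close> holds without a branch correction. Hence the
sum is, up to \<open>- Ln z\<close> and explicit terms, the negative of the series defining \<open>ln_Gamma\<close>.
\<close>

lemma sum_Ln_asymp:
  assumes z: "z \<notin> {of_int n | n :: int. n < 0}"
  shows "(\<lambda>n. (\<Sum>k=1..n. Ln (z + of_nat k)) - (of_real (ln (fact n)) + z * of_real (ln (real n))))
           \<longlonglongrightarrow> ln_sum_offset z"
proof (cases "z = 0")
  case True
  then show ?thesis by (simp only: ln_sum_offset_def add_0 sum_Ln_of_nat) simp
next
  case False
  have "z \<notin> \<int>\<^sub>\<le>\<^sub>0"
    using False z by (rule not_nonpos_Int)
  then have "(\<lambda>n. - Ln z - ln_Gamma_series z n) \<longlonglongrightarrow> - Ln z - ln_Gamma z"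
    by (intro tendsto_intros ln_Gamma_complex_LIMSEQ)
  moreover have "- Ln z - ln_Gamma_series z n =
     (\<Sum>k=1..n. Ln (z + of_nat k)) - (of_real (ln (fact n)) + z * of_real (ln (real n)))"
    if "n > 0" for n
  proof -
    have "Ln (z + of_nat k) = Ln (of_nat k) + Ln (z / of_nat k + 1)" if "k \<in> {1..n}" for k
    proof -
      have k: "k > 0" using that by auto
      have eq: "z + of_nat k = of_nat k * (z / of_nat k + 1)"
        using k by (simp add: field_simps)
      have "z + of_nat k \<noteq> 0"
      proof
        assume "z + of_nat k = 0"
        then have "z = of_int (- int k)" by (simp add: add_eq_0_iff2)
        with k have "z \<in> {of_int n | n :: int. n < 0}"
          by (intro CollectI exI[of _ "- int k"]) auto
        with z show False by blast
      qed
      then have "z / of_nat k + 1 \<noteq> 0" unfolding eq by auto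
      then show ?thesis unfolding eq using k by (rule Ln_times_of_nat[rotated])
    qed
    then have "(\<Sum>k=1..n. Ln (z + of_nat k)) = (\<Sum>k=1..n. Ln (of_nat k) + Ln (z / of_nat k + 1))"
      by (rule sum.cong[OF refl])
    also have "\<dots> = of_real (ln (fact n)) + (\<Sum>k=1..n. Ln (z / of_nat k + 1))"
      by (simp only: sum.distrib sum_Ln_of_nat)
    finally show ?thesis using that by (simp add: ln_Gamma_series_def Ln_of_nat_eq)
  qed
  with eventually_gt_at_top[of 0] have "eventually (\<lambda>n. - Ln z - ln_Gamma_series z n =
     (\<Sum>k=1..n. Ln (z + of_nat k)) - (of_real (ln (fact n)) + z * of_real (ln (real n)))) sequentially"
    by (rule eventually_mono)
  ultimately have "(\<lambda>n. (\<Sum>k=1..n. Ln (z + of_nat k)) - (of_real (ln (fact n)) + z * of_real (ln (real n))))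
     \<longlonglongrightarrow> - Ln z - ln_Gamma z"
    by (rule Lim_transform_eventually)
  then show ?thesis using False by (simp add: ln_sum_offset_def)
qed

lemma exp_ln_sum_offset:
  assumes z: "z \<notin> {of_int n | n :: int. n < 0}"
  shows "exp (- ln_sum_offset z) = Gamma (z + 1)"
proof (cases "z = 0")
  case False
  have nz: "z \<notin> \<int>\<^sub>\<le>\<^sub>0"
    using False z by (rule not_nonpos_Int)
  have "exp (- ln_Gamma z) = rGamma z" using nz by (simp add: rGamma_complex_altdef)
  moreover have "exp (ln_Gamma z) = inverse (exp (- ln_Gamma z))" by (simp add: exp_minus)
  ultimately have "exp (ln_Gamma z) = Gamma z" by (simp only: Gamma_def)
  then show ?thesis using False nz by (simp add: ln_sum_offset_def exp_add Gamma_plus1)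
qed (simp add: ln_sum_offset_def)

text \<open>
These estimates pass from \<open>n = \<lfloor>t\<rfloor>\<close> to \<open>t\<close>, by \<open>ln n = ln t + ln (1 - frac t / t)\<close>.
\<close>

lemma ln_frac_asymp:
  shows "((\<lambda>t::real. t * ln (1 - frac t / t) + frac t) \<longlongrightarrow> 0) at_top"
    and "eventually (\<lambda>t::real. \<bar>ln (1 - frac t / t)\<bar> \<le> 3 / t) at_top"
proof -
  have b: "eventually (\<lambda>t. \<bar>ln (1 - frac t / t) + frac t / t\<bar> \<le> 2 * (1 / t)\<^sup>2) (at_top :: real filter)"
    using eventually_ge_at_top[of "2::real"]
  proof eventually_elim
    case (elim t)
    have f: "0 \<le> frac t" "frac t < 1" by (auto simp: frac_lt_1)
    then have x: "0 \<le> frac t / t" "frac t / t \<le> 1 / t" using elim by (auto intro: divide_right_mono)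
    have "\<bar>ln (1 + - (frac t / t)) - - (frac t / t)\<bar> \<le> 2 * (- (frac t / t))\<^sup>2"
      using f elim by (intro abs_ln_one_plus_x_minus_x_bound) (auto simp: abs_mult field_simps)
    also have "\<dots> \<le> 2 * (1 / t)\<^sup>2" using x by (simp add: power_mono del: power_divide)
    finally show ?case by simp
  qed
  show "((\<lambda>t::real. t * ln (1 - frac t / t) + frac t) \<longlongrightarrow> 0) at_top"
  proof (rule Lim_null_comparison)
    show "eventually (\<lambda>t. norm (t * ln (1 - frac t / t) + frac t) \<le> 2 / t) at_top"
      using b eventually_gt_at_top[of 0]
    proof eventually_elim
      case (elim t)
      have "t * ln (1 - frac t / t) + frac t = t * (ln (1 - frac t / t) + frac t / t)"
        using elim by (simp add: field_simps)
      then have "norm (t * ln (1 - frac t / t) + frac t) = t * \<bar>ln (1 - frac t / t) + frac t / t\<bar>"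
        using elim by (simp add: abs_mult)
      also have "\<dots> \<le> t * (2 * (1 / t)\<^sup>2)" using elim by (intro mult_left_mono) auto
      also have "\<dots> = 2 / t" using elim by (simp add: power2_eq_square)
      finally show ?case .
    qed
    show "((\<lambda>t::real. 2 / t) \<longlongrightarrow> 0) at_top" by real_asymp
  qed
  show "eventually (\<lambda>t::real. \<bar>ln (1 - frac t / t)\<bar> \<le> 3 / t) at_top"
    using b eventually_ge_at_top[of 2]
  proof eventually_elim
    case (elim t)
    have f: "0 \<le> frac t" "frac t < 1" by (auto simp: frac_lt_1)
    have "0 \<le> frac t / t" "frac t / t \<le> 1 / t" using f elim by (auto intro: divide_right_mono)
    moreover have "2 * (1 / t)\<^sup>2 \<le> 2 / t" using elim by (simp add: power2_eq_square field_simps)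
    moreover have "3 / t = 1 / t + 2 / t" by (simp flip: add_divide_distrib)
    ultimately show ?case using elim by linarith
  qed
qed

text \<open>
Put \<open>n = t - frac t\<close> and \<open>Ln \<gamma> = ln t + d\<close>, where \<open>t d\<close> tends to \<open>z\<close>. In Stirling's formula for the partial
sum at \<open>n\<close>, the terms linear in \<open>\<gamma>\<close> cancel, and of the logarithmic terms exactly \<open>(1/2 - frac t) ln t\<close>
remains.
\<close>

lemma partial_sum_ln_expansion:
  assumes z: "z \<notin> {of_int n | n :: int. n < 0}"
    and c: "(\<lambda>n. ln (fact n) - ((real n + 1/2) * ln (real n) - real n)) \<longlonglongrightarrow> c"
  shows "((\<lambda>t. partial_sum_fun ln z t -
      ((z + of_real t) * ln (z + of_real t) - (z + of_real t)) - of_real (sawtooth_ln t))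
      \<longlongrightarrow> of_real c + ln_sum_offset z) at_top"
proof -
  define E1 where "E1 n = (\<Sum>k=1..n. Ln (z + of_nat k)) - (of_real (ln (fact n)) + z * of_real (ln (real n)))" for n
  define E2 where "E2 n = ln (fact n) - ((real n + 1/2) * ln (real n) - real n)" for n
  define d where "d t = Ln (1 + z / of_real t)" for t :: real
  define l where "l t = ln (1 - frac t / t)" for t :: real
  have fl: "filterlim (\<lambda>t::real. nat \<lfloor>t\<rfloor>) at_top at_top"
    by (intro filterlim_compose[OF filterlim_nat_sequentially] filterlim_floor_sequentially)
  have E1: "((\<lambda>t::real. E1 (nat \<lfloor>t\<rfloor>)) \<longlongrightarrow> ln_sum_offset z) at_top"
    using filterlim_compose[OF sum_Ln_asymp[OF z] fl] by (simp add: E1_def[abs_def])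
  have E2: "((\<lambda>t::real. complex_of_real (E2 (nat \<lfloor>t\<rfloor>))) \<longlongrightarrow> of_real c) at_top"
    using filterlim_compose[OF c fl] by (intro tendsto_of_real) (simp add: E2_def[abs_def])
  have r: "((\<lambda>t. complex_of_real (t * l t + frac t)) \<longlongrightarrow> of_real 0) at_top"
    using ln_frac_asymp(1) unfolding l_def[symmetric] by (rule tendsto_of_real)
  have lim3: "((\<lambda>t::real. 3 / t) \<longlongrightarrow> 0) at_top" by real_asymp
  have l: "(l \<longlongrightarrow> 0) at_top"
    by (rule Lim_null_comparison[OF _ lim3]) (use ln_frac_asymp(2) in \<open>simp add: l_def\<close>)
  have l2: "((\<lambda>t. (1/2 - frac t) * l t) \<longlongrightarrow> 0) at_top"
  proof (rule Lim_null_comparison[OF _ lim3])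
    show "eventually (\<lambda>t. norm ((1/2 - frac t) * l t) \<le> 3 / t) at_top"
      using ln_frac_asymp(2)
    proof eventually_elim
      case (elim t)
      have "0 \<le> frac t" "frac t < 1" by (auto simp: frac_lt_1)
      then have "\<bar>1/2 - frac t\<bar> \<le> 1" by linarith
      then have "\<bar>1/2 - frac t\<bar> * \<bar>l t\<bar> \<le> 1 * \<bar>l t\<bar>" by (intro mult_right_mono) auto
      with elim show ?case by (simp add: abs_mult l_def)
    qed
  qed
  have B: "((\<lambda>t. sawtooth_integral t / t) \<longlongrightarrow> 0) at_top"
  proof (rule Lim_null_comparison)
    show "eventually (\<lambda>t. norm (sawtooth_integral t / t) \<le> 1 / t) at_top"
      using eventually_gt_at_top[of 0]
      by eventually_elim (use sawtooth_integral_bounds in \<open>auto intro!: divide_right_mono\<close>)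
    show "((\<lambda>t::real. 1 / t) \<longlongrightarrow> 0) at_top" by real_asymp
  qed
  have "((\<lambda>t. E1 (nat \<lfloor>t\<rfloor>) + of_real (E2 (nat \<lfloor>t\<rfloor>)) + of_real (t * l t + frac t)
      + of_real ((1/2 - frac t) * l t) + z * of_real (l t) - of_real t * d t - z * d t + z
      - of_real (sawtooth_integral t / t)) \<longlongrightarrow>
      ln_sum_offset z + of_real c + of_real 0 + of_real 0 + z * of_real 0 - z - z * 0 + z - of_real 0) at_top"
    by (intro tendsto_intros E1 E2 r tendsto_of_real l l2 B Ln_shift_asymp[of z, folded d_def]
        ln_negligible_tendsto[OF ln_negligible_Ln_shift[of z], folded d_def])
  then have "((\<lambda>t. E1 (nat \<lfloor>t\<rfloor>) + of_real (E2 (nat \<lfloor>t\<rfloor>)) + of_real (t * l t + frac t)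
      + of_real ((1/2 - frac t) * l t) + z * of_real (l t) - of_real t * d t - z * d t + z
      - of_real (sawtooth_integral t / t)) \<longlongrightarrow> of_real c + ln_sum_offset z) at_top"
    by (simp add: add.commute)
  then show ?thesis
  proof (rule Lim_transform_eventually)
    show "eventually (\<lambda>t. E1 (nat \<lfloor>t\<rfloor>) + of_real (E2 (nat \<lfloor>t\<rfloor>)) + of_real (t * l t + frac t)
      + of_real ((1/2 - frac t) * l t) + z * of_real (l t) - of_real t * d t - z * d t + z
      - of_real (sawtooth_integral t / t) = partial_sum_fun ln z t -
      ((z + of_real t) * ln (z + of_real t) - (z + of_real t)) - of_real (sawtooth_ln t)) at_top"
      using eventually_gt_at_top[of "norm z"] eventually_ge_at_top[of 1]
    proof eventually_elim
      case (elim t)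
      define n where "n = nat \<lfloor>t\<rfloor>"
      have n: "real n = t - frac t" using elim by (simp add: n_def frac_def)
      have n1: "real n \<ge> 1" unfolding n_def using elim by (simp add: le_nat_floor)
      have "t * (1 - frac t / t) = t - frac t" using elim by (simp add: right_diff_distrib)
      then have "real n = t * (1 - frac t / t)" using n by (simp only:)
      moreover have "1 - frac t / t > 0"
        using frac_lt_1[of t] elim by simp
      ultimately have lnn: "ln (real n) = ln t + l t"
        using elim by (simp add: ln_mult l_def)
      have E2': "E2 n + ((real n + 1/2) * ln (real n) - real n) = ln (fact n)" by (simp add: E2_def)
      have F: "partial_sum_fun ln z t = E1 n + (of_real (ln (fact n)) + z * of_real (ln (real n)))"
        by (simp add: E1_def partial_sum_fun_def n_def)
      have L: "Ln (z + of_real t) = of_real (ln t) + d t"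
        using Ln_shift(3)[of z t] elim by (simp add: d_def)
      show ?case
        unfolding n_def[symmetric] F E2'[symmetric] L lnn sawtooth_ln_def
        unfolding n by (simp add: algebra_simps)
    qed
  qed
qed

text \<open>
The product is continuous even if the ray runs along the branch cut and through \<open>0\<close>: on the real line the
imaginary part of \<open>Ln\<close> jumps only at \<open>0\<close>, where the factor in front vanishes.
\<close>

lemma continuous_mult_Ln_line: "continuous_on UNIV (\<lambda>t. (z + of_real t) * Ln (z + of_real t))"
proof (cases "Im z = 0")
  case False
  then show ?thesis
    by (intro continuous_intros) (auto simp: complex_nonpos_Reals_iff)
next
  case True
  have "isCont (\<lambda>x::real. x * ln \<bar>x\<bar>) x" for x
  proof (cases "x = 0")
    case True
    have "((\<lambda>x::real. x * ln \<bar>x\<bar>) \<longlongrightarrow> 0) (at 0)" by real_asymp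
    then show ?thesis by (simp add: isCont_def True)
  qed (auto intro!: continuous_intros)
  then have c: "continuous_on UNIV (\<lambda>x::real. x * ln \<bar>x\<bar>)"
    by (simp add: continuous_at_imp_continuous_on)
  have eq: "complex_of_real x * Ln (of_real x) = of_real (x * ln \<bar>x\<bar>) + \<i> * of_real (pi * min x 0)" for x
  proof -
    consider "x = 0" | "x > 0" | "x < 0" by linarith
    then show ?thesis
    proof cases
      case 3
      have "Ln (of_real x) = Ln (- of_real (- x))" by simp
      also have "\<dots> = of_real (ln (- x)) + \<i> * of_real pi"
        using 3 by (subst Ln_minus) (auto simp: Ln_of_real simp del: of_real_minus)
      finally show ?thesis using 3 by (simp add: algebra_simps)
    qed (auto simp: Ln_of_real)
  qed
  have z: "z + of_real t = of_real (Re z + t)" for t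
    using True by (simp add: complex_eq_iff)
  have "continuous_on UNIV (\<lambda>t. Re z + t)" by (intro continuous_intros)
  from continuous_on_compose2[OF c this]
  have "continuous_on UNIV (\<lambda>t. (Re z + t) * ln \<bar>Re z + t\<bar>)" by simp
  then show ?thesis unfolding z eq
    by (rule continuous_on_add[OF continuous_on_of_real]) (intro continuous_intros)
qed

lemma partial_sum_fun_integrable: "t \<ge> 0 \<Longrightarrow> partial_sum_fun f z integrable_on {0..t}"
proof -
  have "partial_sum_fun f z integrable_on {0..real k}" for k
  proof (induction k)
    case (Suc k)
    have "partial_sum_fun f z integrable_on {real k..real (Suc k)}"
    proof (rule integrable_spike_finite)
      show "finite {real (Suc k)}" by simp
      show "(\<lambda>_. \<Sum>n=1..k. f (z + of_nat n)) integrable_on {real k..real (Suc k)}"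
        by (rule integrable_const_ivl)
      fix x assume x: "x \<in> {real k..real (Suc k)} - {real (Suc k)}"
      then have "\<lfloor>x\<rfloor> = int k" by (auto simp: floor_eq_iff)
      then show "partial_sum_fun f z x = (\<Sum>n=1..k. f (z + of_nat n))"
        by (simp add: partial_sum_fun_def)
    qed
    with Suc show ?case by (rule Henstock_Kurzweil_Integration.integrable_combine[rotated 2]) auto
  qed (use integrable_on_refl[of "partial_sum_fun f z" "0::real"] in simp)
  moreover assume "t \<ge> 0"
  then have "{0..t} \<subseteq> {0..real (nat \<lceil>t\<rceil>)}" by auto
  ultimately show ?thesis by (metis integrable_subinterval_real)
qed

section \<open>Existence, uniqueness and the Gamma function\<close>

lemma smallo_growth_of_tendsto:
  assumes "(f \<longlongrightarrow> L) at_top" "\<sigma> \<ge> 0"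
  shows "(\<lambda>t. f t - L) \<in> o[at_top](growth \<sigma>)"
proof -
  have "(\<lambda>t. f t - L) \<in> o[at_top](\<lambda>_. 1)"
    using assms(1) by (intro smalloI_tendsto) (auto simp: LIM_zero_iff)
  from this one_bigo_growth[OF assms(2)] show ?thesis by (rule landau_o.small_big_trans)
qed

lemma cesaro_mean_tendsto:
  assumes u: "\<And>t. t \<ge> 0 \<Longrightarrow> u integrable_on {0..t}"
    and lim: "((\<lambda>t. u t - \<kappa> * of_real (sawtooth_ln t)) \<longlongrightarrow> L) at_top"
  shows "(cesaro_mean u \<longlongrightarrow> L) at_top"
proof -
  have "(\<lambda>t. u t - (L + exp_poly {} (\<lambda>_. 0) (of_real (ln t)) + \<kappa> * of_real (sawtooth_ln t)))
      \<in> o[at_top](growth 0)"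
    using smallo_growth_of_tendsto[OF lim order_refl] by (simp add: exp_poly_def algebra_simps)
  from cesaro_mean_expansion[OF u order_refl _ this]
  have "(\<lambda>t. cesaro_mean u t - L) \<in> o[at_top](growth 0)" by (simp add: exp_poly_def)
  moreover have "o[at_top](growth 0) = o[at_top](\<lambda>_. 1)"
    by (rule landau_o.small.cong, rule eventually_mono[OF eventually_gt_at_top[of 0]]) auto
  ultimately have "(\<lambda>t. cesaro_mean u t - L) \<in> o[at_top](\<lambda>_. 1)" by simp
  then show ?thesis by (auto dest: smalloD_tendsto simp: LIM_zero_iff)
qed

lemma remainder_sum_ln_exists:
  assumes z: "z \<notin> {of_int n | n :: int. n < 0}"
    and c: "(\<lambda>n. ln (fact n) - ((real n + 1/2) * ln (real n) - real n)) \<longlonglongrightarrow> c"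
  shows "has_remainder_cesaro_sum ln z (of_real c + ln_sum_offset z)"
proof -
  define R where "R t = partial_sum_fun ln z t - ((z + of_real t) * ln (z + of_real t) - (z + of_real t))" for t
  have int: "R integrable_on {0..t}" if "t \<ge> 0" for t
    unfolding R_def
    by (intro integrable_diff partial_sum_fun_integrable that integrable_continuous_interval
        continuous_intros continuous_on_subset[OF continuous_mult_Ln_line]) auto
  have lim: "(cesaro_mean R \<longlongrightarrow> of_real c + ln_sum_offset z) at_top"
    using partial_sum_ln_expansion[OF z c] cesaro_mean_tendsto[OF int, of 1] by (simp add: R_def)
  have one: "w powr 1 = w" for w :: complex by (simp add: powr_def)
  show ?thesis
    unfolding has_remainder_cesaro_sum_def has_gen_cesaro_limit_def
    by (rule exI[of _ 2], rule exI[of _ "\<lambda>j. if j = 1 then 1 else -1"], rule exI[of _ "\<lambda>_. 1"],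
        rule exI[of _ "\<lambda>j. if j = 1 then 1 else 0"], rule exI[of _ R], rule exI[of _ 1])
       (use int lim in \<open>auto simp: R_def horizontal_ray_def one numeral_2_eq_2\<close>)
qed

lemma power_log_sum_as_exp_poly:
  fixes a \<rho> :: "nat \<Rightarrow> complex"
  assumes "finite B" "\<rho> ` {1..n} \<subseteq> B" "w \<noteq> 0"
  shows "exp_poly B (\<lambda>\<beta>. \<Sum>j\<in>{j\<in>{1..n}. \<rho> j = \<beta>}. monom (a j) (m j)) (Ln w)
    = (\<Sum>j=1..n. a j * w powr \<rho> j * Ln w ^ m j)"
proof -
  have "exp_poly B (\<lambda>\<beta>. \<Sum>j\<in>{j\<in>{1..n}. \<rho> j = \<beta>}. monom (a j) (m j)) (Ln w) =
    (\<Sum>\<beta>\<in>B. \<Sum>j\<in>{j\<in>{1..n}. \<rho> j = \<beta>}. a j * w powr \<rho> j * Ln w ^ m j)"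
    unfolding exp_poly_def using assms(3)
    by (intro sum.cong refl) (auto simp: poly_sum poly_monom sum_distrib_right powr_def intro!: sum.cong)
  also have "\<dots> = (\<Sum>j=1..n. a j * w powr \<rho> j * Ln w ^ m j)"
    by (rule sum.group) (use assms in auto)
  finally show ?thesis .
qed

lemma exp_poly_add: "exp_poly B (\<lambda>\<beta>. p \<beta> + q \<beta>) s = exp_poly B p s + exp_poly B q s"
  by (simp add: exp_poly_def distrib_right sum.distrib)

lemma exp_poly_single:
  assumes "finite B" "\<beta>0 \<in> B"
  shows "exp_poly B (\<lambda>\<beta>. if \<beta> = \<beta>0 then p else 0) s = poly p s * exp (\<beta>0 * s)"
proof -
  have "exp_poly B (\<lambda>\<beta>. if \<beta> = \<beta>0 then p else 0) s = (\<Sum>\<beta>\<in>B. if \<beta> = \<beta>0 then poly p s * exp (\<beta> * s) else 0)"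
    unfolding exp_poly_def by (intro sum.cong) auto
  then show ?thesis using assms by simp
qed

text \<open>
A decomposition with \<open>N = 0\<close> gives no integrability of \<open>R\<close>, and the gauge terms may indeed have
nonintegrable singularities where the ray meets \<open>0\<close>. Cutting \<open>R\<close> off before \<open>\<gamma>\<close> enters the right
half-plane for good keeps its limit and makes it integrable, which reduces this case to \<open>N = 1\<close>.
\<close>

lemma truncated_remainder:
  fixes z :: complex and F R :: "real \<Rightarrow> complex"
  assumes F: "\<And>t. t \<ge> 0 \<Longrightarrow> F integrable_on {0..t}"
    and R: "\<And>t. t \<ge> 0 \<Longrightarrow> F t = (\<Sum>j=1..n. a j * (z + of_real t) powr \<rho> j * ln (z + of_real t) ^ m j) + R t"
    and t: "t \<ge> 0"
  shows "(\<lambda>t. if t < norm z + 1 then 0 else R t) integrable_on {0..t}" (is "?u integrable_on _")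
proof -
  define T where "T = norm z + 1"
  have T: "T > 0" unfolding T_def using norm_ge_zero[of z] by linarith
  have 1: "?u integrable_on {0..T}"
    by (rule integrable_spike_finite[of "{T}" _ _ "\<lambda>_. 0"]) (auto simp: T_def)
  have 2: "?u integrable_on {T..b}" if "b \<ge> T" for b
  proof -
    have "z + of_real x \<notin> \<real>\<^sub>\<le>\<^sub>0" if "x \<ge> T" for x
      using that abs_Re_le_cmod[of z] unfolding T_def by (auto simp: complex_nonpos_Reals_iff)
    then have nz: "z + of_real x \<notin> \<real>\<^sub>\<le>\<^sub>0 \<and> z + of_real x \<noteq> 0" if "x \<ge> T" for x
      using that by fastforce
    then have "continuous_on {T..b} (\<lambda>t. \<Sum>j=1..n. a j * exp (\<rho> j * ln (z + of_real t)) * ln (z + of_real t) ^ m j)"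
      by (intro continuous_intros) auto
    then have "(\<lambda>t. F t - (\<Sum>j=1..n. a j * exp (\<rho> j * ln (z + of_real t)) * ln (z + of_real t) ^ m j)) integrable_on {T..b}"
      using T that by (intro integrable_diff integrable_continuous_interval
          integrable_subinterval_real[OF F[of b]]) auto
    then show ?thesis
    proof (rule integrable_eq)
      fix x assume x: "x \<in> {T..b}"
      then show "F x - (\<Sum>j=1..n. a j * exp (\<rho> j * ln (z + of_real x)) * ln (z + of_real x) ^ m j) = ?u x"
        using R[of x] T nz[of x] by (simp add: powr_def T_def)
    qed
  qed
  have "?u integrable_on {0..max t T}"
    by (rule Henstock_Kurzweil_Integration.integrable_combine[OF _ _ 1 2]) (use T in auto)
  then show ?thesis by (rule integrable_subinterval_real) (use t in auto)
qed

text \<open>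
If \<open>L \<noteq> C\<close>, the exponent \<open>0\<close> occurs in the collected expansion of \<open>R - L\<close>, with the constant polynomial
\<open>C - L\<close>. So there are leading terms, of some order \<open>\<sigma> \<ge> 0\<close>, contrary to the existence of the Cesaro limit.
\<close>

lemma remainder_sum_ln_unique:
  assumes z: "z \<notin> {of_int n | n :: int. n < 0}"
    and c: "(\<lambda>n. ln (fact n) - ((real n + 1/2) * ln (real n) - real n)) \<longlonglongrightarrow> c"
    and L: "has_remainder_cesaro_sum ln z L"
  shows "L = of_real c + ln_sum_offset z"
proof (rule ccontr)
  define C where "C = of_real c + ln_sum_offset z"
  assume "L \<noteq> of_real c + ln_sum_offset z"
  then have CL: "C - L \<noteq> 0" by (simp add: C_def)
  define F where "F = partial_sum_fun ln z"
  obtain n :: nat and a \<rho> :: "nat \<Rightarrow> complex" and m :: "nat \<Rightarrow> nat" and R N where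
    dec: "(\<forall>j\<in>{1..n}. \<rho> j \<noteq> 0) \<and>
      (\<forall>t\<ge>0. F t = (\<Sum>j=1..n. a j * (z + of_real t) powr \<rho> j * ln (z + of_real t) ^ m j) + R t) \<and>
      (\<forall>k<N. \<forall>t\<ge>0. (cesaro_mean ^^ k) R integrable_on {0..t}) \<and>
      ((cesaro_mean ^^ N) R \<longlongrightarrow> L) at_top"
    using L[unfolded has_remainder_cesaro_sum_def has_gen_cesaro_limit_def horizontal_ray_def, folded F_def]
    by (elim exE) (erule that)
  have \<rho>: "\<rho> j \<noteq> 0" if "j \<in> {1..n}" for j
    using dec that by blast
  have R: "F t = (\<Sum>j=1..n. a j * (z + of_real t) powr \<rho> j * ln (z + of_real t) ^ m j) + R t" if "t \<ge> 0" for t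
    using dec that by blast
  have int: "(cesaro_mean ^^ k) R integrable_on {0..t}" if "k < N" "t \<ge> 0" for k t
    using dec that by blast
  have lim: "((cesaro_mean ^^ N) R \<longlongrightarrow> L) at_top"
    using dec by blast
  \<comment> \<open>The oscillating term dies only under averaging, so at least one averaging must be available.\<close>
  have "\<exists>u N'. N' > 0 \<and> (\<forall>k<N'. \<forall>t\<ge>0. (cesaro_mean ^^ k) u integrable_on {0..t}) \<and>
      ((cesaro_mean ^^ N') u \<longlongrightarrow> L) at_top \<and> eventually (\<lambda>t. u t = R t) at_top"
  proof (cases "N = 0")
    case False
    with int lim show ?thesis by (intro exI[of _ R] exI[of _ N]) auto
  next
    case True
    define u where "u t = (if t < norm z + 1 then 0 else R t)" for t
    have ev: "eventually (\<lambda>t. u t = R t) at_top"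
      using eventually_ge_at_top[of "norm z + 1"] by eventually_elim (simp add: u_def)
    have iu: "u integrable_on {0..t}" if "t \<ge> 0" for t
      using truncated_remainder[OF partial_sum_fun_integrable[of _ ln z, folded F_def] R that]
      unfolding u_def .
    have "(R \<longlongrightarrow> L) at_top" using lim True by simp
    then have "(u \<longlongrightarrow> L) at_top"
      by (rule Lim_transform_eventually) (use ev in \<open>auto elim: eventually_mono\<close>)
    then have "(cesaro_mean u \<longlongrightarrow> L) at_top"
      using cesaro_mean_tendsto[OF iu, of 0] by simp
    then show ?thesis using iu ev by (intro exI[of _ u] exI[of _ 1]) auto
  qed
  then obtain u N' where N': "N' > 0"
    and iu: "\<And>k t. k < N' \<Longrightarrow> t \<ge> 0 \<Longrightarrow> (cesaro_mean ^^ k) u integrable_on {0..t}"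
    and lu: "((cesaro_mean ^^ N') u \<longlongrightarrow> L) at_top"
    and eu: "eventually (\<lambda>t. u t = R t) at_top"
    by blast
  define B0 where "B0 = insert 0 (insert 1 (\<rho> ` {1..n}))"
  \<comment> \<open>The collected coefficients of \<open>\<gamma> ln \<gamma> - \<gamma> - g + (C - L)\<close>.\<close>
  define p where "p \<beta> = (\<Sum>j\<in>{j\<in>{1..n}. \<rho> j = \<beta>}. monom (- a j) (m j)) +
      ((if \<beta> = 1 then [:-1, 1:] else 0) + (if \<beta> = 0 then [:C - L:] else 0))" for \<beta>
  have B0: "finite B0" by (simp add: B0_def)
  have p0: "p 0 = [:C - L:]"
  proof -
    have "{j \<in> {1..n}. \<rho> j = 0} = {}" using \<rho> by auto
    then show ?thesis unfolding p_def by (simp only:) simp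
  qed
  define B1 where "B1 = {\<beta>\<in>B0. p \<beta> \<noteq> 0}"
  define \<sigma> where "\<sigma> = Max (Re ` B1)"
  define B2 where "B2 = {\<beta>\<in>B1. Re \<beta> = \<sigma>}"
  have B1: "finite B1" "0 \<in> B1" using B0 p0 CL by (auto simp: B1_def B0_def)
  have \<sigma>: "\<sigma> \<ge> 0" unfolding \<sigma>_def using B1 by (intro Max_ge) (auto intro: rev_image_eqI)
  have le: "Re \<beta> \<le> \<sigma>" if "\<beta> \<in> B1" for \<beta>
    unfolding \<sigma>_def using B1 that by (intro Max_ge) auto
  have "\<sigma> \<in> Re ` B1" unfolding \<sigma>_def using B1 by (intro Max_in) auto
  then have B2ne: "B2 \<noteq> {}" by (auto simp: B2_def)
  have ep01: "exp_poly B0 p s = exp_poly B1 p s" for s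
    unfolding exp_poly_def B1_def using B0 by (intro sum.mono_neutral_right) auto
  have ep: "exp_poly B0 p (Ln w) = w * Ln w - w - (\<Sum>j=1..n. a j * w powr \<rho> j * Ln w ^ m j) + (C - L)"
    if "w \<noteq> 0" for w
  proof -
    have "exp_poly B0 p (Ln w) = (\<Sum>j=1..n. - a j * w powr \<rho> j * Ln w ^ m j) +
       (poly [:-1, 1:] (Ln w) * exp (1 * Ln w) + poly [:C - L:] (Ln w) * exp (0 * Ln w))"
      unfolding p_def exp_poly_add
      by (intro arg_cong2[where f = "(+)"] power_log_sum_as_exp_poly exp_poly_single B0 that)
         (auto simp: B0_def)
    then show ?thesis using that by (simp add: sum_negf algebra_simps)
  qed
  have "((\<lambda>t. F t - ((z + of_real t) * ln (z + of_real t) - (z + of_real t)) - of_real (sawtooth_ln t))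
      \<longlongrightarrow> C) at_top"
    unfolding F_def C_def by (rule partial_sum_ln_expansion[OF z c])
  from sum_in_smallo(1)[OF smallo_growth_of_tendsto[OF this \<sigma>] exp_poly_leading_part[OF B1(1) le, of p z]]
  have "(\<lambda>t. F t - ((z + of_real t) * ln (z + of_real t) - (z + of_real t)) - of_real (sawtooth_ln t) - C
     + (exp_poly B1 p (Ln (z + of_real t)) - exp_poly B2 p (of_real (ln t)))) \<in> o[at_top](growth \<sigma>)"
    unfolding B2_def .
  moreover have "eventually (\<lambda>t. F t - ((z + of_real t) * ln (z + of_real t) - (z + of_real t))
      - of_real (sawtooth_ln t) - C + (exp_poly B1 p (Ln (z + of_real t)) - exp_poly B2 p (of_real (ln t)))
      = u t - (L + exp_poly B2 p (of_real (ln t)) + 1 * of_real (sawtooth_ln t))) at_top"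
    using eu eventually_gt_at_top[of "norm z"]
  proof eventually_elim
    case (elim t)
    have "t \<ge> 0" using elim norm_ge_zero[of z] by linarith
    from R[OF this] have "u t = F t - (\<Sum>j=1..n. a j * (z + of_real t) powr \<rho> j * ln (z + of_real t) ^ m j)"
      using elim by simp
    then show ?case
      using ep[OF Ln_shift(1)[OF elim(2)]] unfolding ep01 by simp
  qed
  ultimately have "(\<lambda>t. u t - (L + exp_poly B2 p (of_real (ln t)) + 1 * of_real (sawtooth_ln t)))
      \<in> o[at_top](growth \<sigma>)"
    by (simp only: landau_o.small.in_cong)
  note expansion = this
  have "B2 = {}"
  proof (rule no_leading_terms_if_cesaro_limit[OF iu \<sigma> N' lu _ _ expansion])
    show "finite B2" using B1 by (simp add: B2_def)
    show "Re \<beta> = \<sigma> \<and> p \<beta> \<noteq> 0" if "\<beta> \<in> B2" for \<beta>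
      using that by (simp add: B2_def B1_def)
  qed
  with B2ne show False by simp
qed

theorem mainTheorem3:
  fixes z0 :: complex
  assumes "z0 \<notin> {of_int n | n :: int. n < 0}"
  shows "(\<exists>!L. has_remainder_cesaro_sum ln z0 L) \<and> Gamma_tilde (z0 + 1) = Gamma (z0 + 1)"
proof -
  obtain c :: real where c: "(\<lambda>n. ln (fact n) - ((real n + 1/2) * ln (real n) - real n)) \<longlonglongrightarrow> c"
    using Stirling_constant_exists by blast
  have val: "remainder_cesaro_sum ln z = of_real c + ln_sum_offset z"
    and ex1: "\<exists>!L. has_remainder_cesaro_sum ln z L"
    if z: "z \<notin> {of_int n | n :: int. n < 0}" for z
  proof -
    show "\<exists>!L. has_remainder_cesaro_sum ln z L"
      using remainder_sum_ln_exists[OF z c] remainder_sum_ln_unique[OF z c] by blast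
    show "remainder_cesaro_sum ln z = of_real c + ln_sum_offset z"
      unfolding remainder_cesaro_sum_def
      using remainder_sum_ln_exists[OF z c] remainder_sum_ln_unique[OF z c] by (rule the_equality)
  qed
  have "0 \<notin> {complex_of_int n | n :: int. n < 0}" by auto
  from val[OF this] val[OF assms]
  have "Gamma_tilde (z0 + 1) = exp (- ln_sum_offset z0)"
    by (simp add: Gamma_tilde_def ln_sum_offset_def[of 0])
  with ex1[OF assms] exp_ln_sum_offset[OF assms] show ?thesis by simp
qed

end
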